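(* Assume that $\boldsymbol{\varepsilon}\sim N(\mathbf{0},\sigma^2\mathbf{I}_n)$, and that there exists a constant $C>0$ such that $\sum_{i=1}^nx_{ij}^2/n\leqslant C$ for any $j\in\mathcal{A}_{0n}$. Suppose that at least one of the following two conditions holds. (a) As $n\to\infty$, $M=o(n\delta_n\beta_{\min}^2)$, and for all $\epsilon>0$, $\sum_{n=1}^\infty\exp(-\epsilon n\delta_n\beta_{\min}^2)<\infty$ and $\sum_{n=1}^\infty\exp\big(-\epsilon n\delta_n^2\beta_{\min}^4/(d\|\boldsymbol{\beta}\|^2)\big)<\infty$. (b) As $n\to\infty$, $M/n\to\alpha\in(0,1)$ and $\mathrm{rank}(\mathbf{H}_{\mathcal{A}_n})/n\to\lambda\in[0,1)$ for all $\{\mathcal{A}_n\}\in\mathfrak{A}\cup\mathfrak{B}$; for all $n$, $\delta_n\beta_{\min}^2\geqslant c$, where $c>0$ is a constant; and for all $\epsilon>0$, $\sum_{n=1}^\infty\exp\big(-\epsilon n/(d\|\boldsymbol{\beta}\|^2)\big)<\infty$. Then the objective functions $$\psi_n(\mathcal{A})=\big\|\mathbf{y}-\mathbf{X}_{\mathcal{A}}\hat{\boldsymbol{\beta}}_{\mathcal{A}}\big\|^2,\quad\mathcal{A}\in\mathfrak{D}_n,$$ (weakly) separate $\mathfrak{A}$ from $\mathfrak{B}$; that is, for all $\{\mathcal{A}_n\}\in\mathfrak{A}$ and $\{\mathcal{B}_n\}\in\mathfrak{B}$, $\limsup_{n\to\infty}[\psi_n(\mathcal{A}_n)-\psi_n(\mathcal{B}_n)]<0$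 almost surely.
   Context: Linear regression model $\mathbf{y}=\mathbf{X}\boldsymbol{\beta}+\boldsymbol{\varepsilon}$ without intercept, where $\mathbf{X}=(x_{ij})$ is the (nonrandom) $n\times p$ regression matrix, $\mathbf{y}\in\mathbb{R}^n$ is the response vector, $\boldsymbol{\beta}=(\beta_1,\ldots,\beta_p)'$ is the true coefficient vector, and $\boldsymbol{\varepsilon}$ is the vector of random errors with variance $\sigma^2$. Both $p$ and $\boldsymbol{\beta}$ may depend on $n$. $\mathbb{Z}_p=\{1,\ldots,p\}$. The true submodel is $\mathcal{A}_{0n}=\{j\in\mathbb{Z}_p:\beta_j\neq0\}$, with $d=|\mathcal{A}_{0n}|$, and $\beta_{\min}$ is the component of $\boldsymbol{\beta}_{\mathcal{A}_{0n}}$ with the smallest absolute value. $M$ (which may depend on $n$) is a specified integer with $d\leqslant M<n$. Decision spaces: $\mathfrak{D}_n=\{\mathcal{A}\subset\mathbb{Z}_p:|\mathcal{A}|=M\}$, $\mathfrak{A}_n=\{\mathcal{A}\in\mathfrak{D}_n:\mathcal{A}\supset\mathcal{A}_{0n}\}$, $\mathfrak{B}_n=\mathfrak{D}_n\setminus\mathfrak{A}_n$, $\mathfrak{A}=\prod_{n=1}^\infty\mathfrak{A}_n$, $\mathfrak{B}=\prod_{n=1}^\infty\mathfrak{B}_n$. For $\mathcal{A}\subset\mathbb{Z}_p$, $\mathbf{X}_{\mathcal{A}}$ is the submatrix of $\mathbf{X}$ consisting of the columns with indices in $\mathcal{A}$ (not necessarily of full column rank), $\hat{\boldsymbol{\beta}}_{\mathcal{A}}=(\mathbf{X}_{\mathcal{A}}'\mathbf{X}_{\mathcal{A}})^{-}\mathbf{X}_{\mathcal{A}}'\mathbf{y}$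 and $\mathbf{H}_{\mathcal{A}}=\mathbf{I}_n-\mathbf{X}_{\mathcal{A}}(\mathbf{X}_{\mathcal{A}}'\mathbf{X}_{\mathcal{A}})^{-}\mathbf{X}_{\mathcal{A}}'$, where $^{-}$ denotes a generalized inverse. With $\lambda_{\min}(\cdot)$ the smallest eigenvalue, $\delta_n=\min_{\mathcal{A}\in\mathfrak{D}_n,\ \mathcal{A}\notin\mathfrak{A}_n}\left[\frac1n\lambda_{\min}(\mathbf{X}_{\mathcal{A}_{0n}\setminus\mathcal{A}}'\mathbf{H}_{\mathcal{A}}\mathbf{X}_{\mathcal{A}_{0n}\setminus\mathcal{A}})\right]$. In condition (b), $\lambda$ is a constant common to all sequences. *)

theory Defs
  imports
    "HOL-Probability.Probability"
    "HOL-Library.Landau_Symbols"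
    "Jordan_Normal_Form.DL_Rank"
    "Jordan_Normal_Form.DL_Submatrix"
    "Jordan_Normal_Form.Spectral_Radius"
begin

no_notation vec_nth (infixl \<open>$\<close> 90)

text \<open>
  Rows and columns are indexed from 0, as in the matrix library: the set of all indices is
  \<open>{..<p}\<close> instead of \<open>{1..p}\<close>.
\<close>

definition sq_norm :: "real vec \<Rightarrow> real" where
  "sq_norm v = scalar_prod v v"

definition is_generalized_inverse :: "real mat \<Rightarrow> real mat \<Rightarrow> bool" where
  "is_generalized_inverse A G \<longleftrightarrow>
     G \<in> carrier_mat (dim_col A) (dim_row A) \<and> A * G * A = A"

definition submat_cols :: "real mat \<Rightarrow> nat set \<Rightarrow> real mat" where
  "submat_cols X A = submatrix X UNIV A"

text \<open>In the next two definitions \<open>ginv\<close> is the operation that picks a generalized inverse.\<close>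

definition beta_hat :: "(real mat \<Rightarrow> real mat) \<Rightarrow> real mat \<Rightarrow> real vec \<Rightarrow> nat set \<Rightarrow> real vec" where
  "beta_hat ginv X y A =
     (let XA = submat_cols X A in (ginv (XA\<^sup>T * XA) * XA\<^sup>T) *\<^sub>v y)"

definition H_mat :: "(real mat \<Rightarrow> real mat) \<Rightarrow> real mat \<Rightarrow> nat set \<Rightarrow> real mat" where
  "H_mat ginv X A =
     (let XA = submat_cols X A in 1\<^sub>m (dim_row X) - XA * ginv (XA\<^sup>T * XA) * XA\<^sup>T)"

definition rss :: "(real mat \<Rightarrow> real mat) \<Rightarrow> real mat \<Rightarrow> real vec \<Rightarrow> nat set \<Rightarrow> real" where
  "rss ginv X y A = sq_norm (y - submat_cols X A *\<^sub>v beta_hat ginv X y A)"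

definition response :: "real mat \<Rightarrow> real vec \<Rightarrow> (nat \<Rightarrow> real) \<Rightarrow> real vec" where
  "response X \<beta> e = X *\<^sub>v \<beta> + vec (dim_row X) e"

definition true_submodel :: "real vec \<Rightarrow> nat set" where
  "true_submodel \<beta> = {j. j < dim_vec \<beta> \<and> vec_index \<beta> j \<noteq> 0}"

text \<open>
  If several components attain the smallest absolute value, one of them is picked; only even
  powers of \<open>beta_min\<close> are used, and they do not depend on the choice.
\<close>
definition beta_min :: "real vec \<Rightarrow> real" where
  "beta_min \<beta> = vec_index \<beta> (arg_min_on (\<lambda>j. \<bar>vec_index \<beta> j\<bar>) (true_submodel \<beta>))"

definition submodels :: "nat \<Rightarrow> nat \<Rightarrow> nat set set" where
  "submodels p m = {A. A \<subseteq> {..<p} \<and> card A = m}"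

definition good_submodels :: "real vec \<Rightarrow> nat \<Rightarrow> nat set set" where
  "good_submodels \<beta> m = {A \<in> submodels (dim_vec \<beta>) m. true_submodel \<beta> \<subseteq> A}"

definition bad_submodels :: "real vec \<Rightarrow> nat \<Rightarrow> nat set set" where
  "bad_submodels \<beta> m = submodels (dim_vec \<beta>) m - good_submodels \<beta> m"

definition lambda_min :: "real mat \<Rightarrow> real" where
  "lambda_min A = Min (spectrum A)"

text \<open>The sample size \<open>n\<close> is the number of rows of \<open>X\<close>.\<close>
definition delta :: "(real mat \<Rightarrow> real mat) \<Rightarrow> real mat \<Rightarrow> real vec \<Rightarrow> nat \<Rightarrow> real" where
  "delta ginv X \<beta> m =
     Min ((\<lambda>A. let Z = submat_cols X (true_submodel \<beta> - A)
               in 1 / real (dim_row X) * lambda_min (Z\<^sup>T * H_mat ginv X A * Z))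
          ` bad_submodels \<beta> m)"

text \<open>
  The law \<open>N(0, \<sigma>\<^sup>2 I\<^sub>n)\<close>, \<open>\<sigma> > 0\<close>, by its joint density
  \<open>(2 \<pi> \<sigma>\<^sup>2) powr (- n / 2) * exp (- \<parallel>x\<parallel>\<^sup>2 / (2 \<sigma>\<^sup>2))\<close>.
\<close>
definition isotropic_normal ::
    "'w measure \<Rightarrow> nat \<Rightarrow> real \<Rightarrow> (nat \<Rightarrow> 'w \<Rightarrow> real) \<Rightarrow> bool" where
  "isotropic_normal P n \<sigma> \<epsilon> \<longleftrightarrow>
     distributed P (\<Pi>\<^sub>M i\<in>{..<n}. lborel) (\<lambda>\<omega>. \<lambda>i\<in>{..<n}. \<epsilon> i \<omega>)
       (\<lambda>x. ennreal (exp (- (\<Sum>i<n. (x i)\<^sup>2) / (2 * \<sigma>\<^sup>2)) / sqrt (2 * pi * \<sigma>\<^sup>2) ^ n))"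

text \<open>
  The exceptional null set may depend on the two sequences of decisions. The limit superior is
  taken in the extended reals, since the differences may tend to \<open>-\<infinity>\<close>.
\<close>
definition weakly_separates ::
    "'w measure \<Rightarrow> (nat \<Rightarrow> 'd \<Rightarrow> 'w \<Rightarrow> real) \<Rightarrow> (nat \<Rightarrow> 'd) set \<Rightarrow> (nat \<Rightarrow> 'd) set \<Rightarrow> bool" where
  "weakly_separates P \<psi> FA FB \<longleftrightarrow>
     (\<forall>A\<in>FA. \<forall>B\<in>FB. AE \<omega> in P. limsup (\<lambda>n. ereal (\<psi> n (A n) \<omega> - \<psi> n (B n) \<omega>)) < 0)"

end

theory Submission
  imports Defs
begin

text \<open>
  Write \<open>y = \<mu> + e\<close> with \<open>\<mu> = X \<beta>\<close>, let \<open>K\<close> be the orthogonal projection onto the column space of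
  \<open>X\<^sub>A\<close>, and \<open>H = I - K\<close>. The objective function is the squared norm of \<open>H y\<close>. For a good submodel \<open>A\<close>
  the mean \<open>\<mu>\<close> lies in the column space, so only \<open>H\<^sub>A e\<close> remains; for a bad submodel \<open>B\<close> the part
  \<open>v = H\<^sub>B \<mu>\<close> survives. With \<open>|H e|\<^sup>2 = |e|\<^sup>2 - |K e|\<^sup>2\<close> the difference of the objective functions is
  \<open>|H\<^sub>A e|\<^sup>2 + |K\<^sub>B e|\<^sup>2 - |e|\<^sup>2 - 2 v \<bullet> e - |v|\<^sup>2\<close>.

  The signal is \<open>|v|\<^sup>2\<close>. It is the quadratic form of the matrix whose smallest eigenvalue enters
  \<open>\<delta>\<close>, taken at the coefficients that \<open>B\<close> misses, and hence it is at least \<open>s = n \<delta> beta_min\<^sup>2\<close>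
  (lemma \<open>delta_beta_min_le_sq_norm_v\<close>).

  The noise is controlled by exponential moments. The cross term \<open>2 v \<bullet> e\<close> is Gaussian with
  variance \<open>4 \<sigma>\<^sup>2 |v|\<^sup>2\<close>, so it exceeds \<open>|v|\<^sup>2 / 2\<close> only with probability at most
  \<open>exp (- |v|\<^sup>2 / (32 \<sigma>\<^sup>2))\<close>. The squared norm of a projection of rank \<open>r\<close> has mean \<open>\<sigma>\<^sup>2 r\<close>, and
  for every scale \<open>t \<ge> r\<close> it exceeds \<open>\<sigma>\<^sup>2 r + \<eta> t\<close> only with probability at most \<open>exp (- c t)\<close>,
  for some \<open>c > 0\<close> that depends only on \<open>\<eta>\<close> and \<open>\<sigma>\<close>; the lower tail of \<open>|e|\<^sup>2\<close> behaves in the same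
  way. With \<open>t = s\<close> under condition (a) and \<open>t = n\<close> under condition (b) these probabilities are summable,
  so by the Borel-Cantelli lemma the bounds hold almost surely for all large \<open>n\<close>
  (lemmas \<open>AE_eventually_cross_term_le\<close>, \<open>AE_eventually_sq_norm_projection_le\<close> and
  \<open>AE_eventually_sq_norm_ge\<close>).

  Under condition (a) it suffices to drop \<open>|H\<^sub>A e|\<^sup>2 - |e|\<^sup>2 \<le> 0\<close>: the rank of \<open>K\<^sub>B\<close> is at most
  \<open>M = o(s)\<close>, so all noise is at most \<open>s / 4 + |v|\<^sup>2 / 2\<close>. Under condition (b) the ranks may be of the same
  order as \<open>n\<close> and the means have to cancel: they add up to
  \<open>\<sigma>\<^sup>2 (rank H\<^sub>A + rank K\<^sub>B - n) = \<sigma>\<^sup>2 (rank H\<^sub>A - rank H\<^sub>B)\<close>, which is \<open>o(n)\<close> because both ranks,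
  divided by \<open>n\<close>, have the same limit, while \<open>s\<close> is at least of order \<open>n\<close>.
\<close>

(* From here on the bullet is the scalar product of real vec. *)
no_notation inner (infix \<open>\<bullet>\<close> 70)

section \<open>Squared norms of projections as sums of orthonormal squares\<close>

lemma scalar_prod_eq_sum: "u \<bullet> v = (\<Sum>i<dim_vec v. u $ i * v $ i)"
  by (simp add: scalar_prod_def atLeast0LessThan)

lemma sq_norm_eq_sum: "sq_norm v = (\<Sum>i<dim_vec v. (v $ i)\<^sup>2)"
  by (simp add: sq_norm_def scalar_prod_eq_sum power2_eq_square)

lemma sq_norm_nonneg: "sq_norm v \<ge> 0"
  unfolding sq_norm_eq_sum by (intro sum_nonneg) auto

lemma sq_norm_eq_0_iff: "v \<in> carrier_vec n \<Longrightarrow> sq_norm v = 0 \<longleftrightarrow> v = 0\<^sub>v n"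
  unfolding sq_norm_eq_sum by (subst sum_nonneg_eq_0_iff) auto

lemma mult_mat_vec_in_span_cols:
  fixes X :: "real mat"
  assumes X: "X \<in> carrier_mat n m" and w: "w \<in> carrier_vec m"
  shows "X *\<^sub>v w \<in> LinearCombinations.module.span class_ring (module_vec TYPE(real) n) (set (cols X))"
proof -
  interpret vec_space "TYPE(real)" n .
  have sub: "set (cols X) \<subseteq> carrier_vec n" using cols_dim[of X] X by simp
  have 1: "lincomb_list (\<lambda>i. w $ i) (cols X) = mat_of_cols n (cols X) *\<^sub>v vec (length (cols X)) (\<lambda>i. w $ i)"
    by (rule lincomb_list_as_mat_mult) (use sub in auto)
  have 2: "mat_of_cols n (cols X) = X" using mat_of_cols_cols[of X] X by simp
  have 3: "vec (length (cols X)) (\<lambda>i. w $ i) = w" by (rule eq_vecI) (use X w in simp_all)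
  have "X *\<^sub>v w \<in> span_list (cols X)"
    unfolding span_list_def 1[unfolded 2 3, symmetric] by blast
  thus ?thesis using span_list_as_span[OF sub] by simp
qed

text \<open>
  A maximal independent set of columns spans the column space and has as many elements as the
  rank; Gram-Schmidt makes it orthogonal without changing its span or its length.
\<close>
lemma orthogonal_basis_of_column_space:
  fixes X :: "real mat"
  assumes X: "X \<in> carrier_mat n m"
  obtains us where "length us = vec_space.rank n X" "set us \<subseteq> carrier_vec n"
    "\<And>i j. i < length us \<Longrightarrow> j < length us \<Longrightarrow> us ! i \<bullet> us ! j = 0 \<longleftrightarrow> i \<noteq> j"
    "\<And>w. w \<in> carrier_vec m \<Longrightarrow> \<exists>c. X *\<^sub>v w = mat_of_cols n us *\<^sub>v vec (length us) c"
    "\<And>i. i < length us \<Longrightarrow> \<exists>c \<in> carrier_vec m. us ! i = X *\<^sub>v c"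
proof -
  interpret vec_space "TYPE(real)" n .
  interpret cof_vec_space n "TYPE(real)" .
  have sub: "set (cols X) \<subseteq> carrier_vec n" using cols_dim[of X] X by simp
  obtain S where S: "maximal S (\<lambda>T. T \<subseteq> set (cols X) \<and> lin_indpt T)" "finite S"
    using maximal_exists_superset[of "set (cols X)" "\<lambda>T. T \<subseteq> set (cols X) \<and> lin_indpt T" "{}"]
    by (auto simp: lin_dep_def)
  have S': "S \<subseteq> set (cols X)" "lin_indpt S" using S(1) unfolding maximal_def by auto
  have rk: "rank X = card S" by (rule rank_card_indpt[OF X S(1)])
  have Sc: "S \<subseteq> carrier_vec n" using S' sub by blast
  have colS: "set (cols X) \<subseteq> span S"
  proof
    fix s assume s: "s \<in> set (cols X)"
    show "s \<in> span S"
    proof (rule ccontr)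
      assume ns: "s \<notin> span S"
      have "lin_indpt (S \<union> {s})"
        using ns S' Sc s sub by (meson lin_dep_iff_in_span subsetD span_mem)
      moreover have "s \<notin> S" using ns Sc span_mem by auto
      ultimately show False using S(1) s S'(1) unfolding maximal_def by blast
    qed
  qed
  have spanX: "span (set (cols X)) = span S"
    by (metis S'(1) Sc colS span_is_monotone span_is_submodule span_is_subset subset_antisym)
  obtain ws where ws: "set ws = S" "distinct ws" using finite_distinct_list[OF S(2)] by auto
  define us where "us = gram_schmidt n ws"
  have gs: "span S = span (set us)" "corthogonal us" "set us \<subseteq> carrier_vec n" "length us = length ws" "distinct us"
    using gram_schmidt_result[of ws us] ws Sc S' us_def by auto
  show ?thesis
  proof (rule that[of us])
    show "length us = rank X" using gs rk ws distinct_card by metis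
    show "set us \<subseteq> carrier_vec n" by fact
    show "us ! i \<bullet> us ! j = 0 \<longleftrightarrow> i \<noteq> j" if "i < length us" "j < length us" for i j
      using corthogonalD[OF gs(2) that] by (simp add: conjugate_vec_def scalar_prod_def)
    show "\<exists>c. X *\<^sub>v w = mat_of_cols n us *\<^sub>v vec (length us) c" if "w \<in> carrier_vec m" for w
    proof -
      have "X *\<^sub>v w \<in> span_list us"
        using mult_mat_vec_in_span_cols[OF X that] spanX gs span_list_as_span[OF gs(3)] by simp
      then obtain c where c: "X *\<^sub>v w = lincomb_list c us" unfolding span_list_def by auto
      have "\<forall>w\<in>set us. dim_vec w = n" using gs(3) by auto
      from lincomb_list_as_mat_mult[OF this, of c] c show ?thesis by metis
    qed
    show "\<exists>c \<in> carrier_vec m. us ! i = X *\<^sub>v c" if i: "i < length us" for i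
    proof -
      have "us ! i \<in> span_list (cols X)"
        unfolding span_list_as_span[OF sub] spanX gs(1) using gs(3) i by (intro span_mem) auto
      then obtain c where "us ! i = lincomb_list c (cols X)" unfolding span_list_def by auto
      also have "\<dots> = mat_of_cols n (cols X) *\<^sub>v vec (length (cols X)) c"
        by (rule lincomb_list_as_mat_mult) (use sub in auto)
      finally show ?thesis using X by (intro bexI[of _ "vec m c"]) auto
    qed
  qed
qed

text \<open>
  The quadratic form \<open>|K e|\<^sup>2\<close> in coordinates along an orthonormal system of length \<open>r\<close>. This is the
  only property of a projection that its exponential moments depend on.
\<close>
definition orthonormal_squares :: "nat \<Rightarrow> nat \<Rightarrow> real mat \<Rightarrow> bool" where
  "orthonormal_squares n r K \<longleftrightarrow> (\<exists>u. (\<forall>k. u k \<in> carrier_vec n)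
     \<and> (\<forall>k<r. \<forall>l<r. u k \<bullet> u l = (if k = l then 1 else 0))
     \<and> (\<forall>e\<in>carrier_vec n. sq_norm (K *\<^sub>v e) = (\<Sum>k<r. (u k \<bullet> e)\<^sup>2)))"

text \<open>
  If \<open>K X = X\<close> and \<open>K = X Y\<close>, then \<open>K\<close> fixes the column space of \<open>X\<close> and maps into it. So the
  coordinate of \<open>K e\<close> along a unit vector \<open>u\<close> of this space is \<open>u \<bullet> K e = K u \<bullet> e = u \<bullet> e\<close>.
  The matrix \<open>X\<close> is kept separate from \<open>K\<close> so that the length of the orthonormal system can be read off
  either as the rank of a projection or as the rank of a submatrix of the design.
\<close>
lemma orthogonal_projection_sum_of_squares:
  fixes K X Y :: "real mat"
  assumes K: "K \<in> carrier_mat n n" and sym: "K\<^sup>T = K" and X: "X \<in> carrier_mat n m"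
    and KX: "K * X = X" and Y: "Y \<in> carrier_mat m n" and KXY: "K = X * Y"
  shows "orthonormal_squares n (vec_space.rank n X) K"
proof -
  obtain us where us: "length us = vec_space.rank n X" "set us \<subseteq> carrier_vec n"
    "\<And>i j. i < length us \<Longrightarrow> j < length us \<Longrightarrow> us ! i \<bullet> us ! j = 0 \<longleftrightarrow> i \<noteq> j"
    "\<And>w. w \<in> carrier_vec m \<Longrightarrow> \<exists>c. X *\<^sub>v w = mat_of_cols n us *\<^sub>v vec (length us) c"
    "\<And>i. i < length us \<Longrightarrow> \<exists>c \<in> carrier_vec m. us ! i = X *\<^sub>v c"
    by (rule orthogonal_basis_of_column_space[OF X]) blast
  define r where "r = vec_space.rank n X"
  define N where "N k = sqrt (us ! k \<bullet> us ! k)" for k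
  define u where "u k = (if k < r then (1 / N k) \<cdot>\<^sub>v (us ! k) else 0\<^sub>v n)" for k
  have usc: "us ! k \<in> carrier_vec n" if "k < r" for k using us(1,2) that r_def by auto
  have Npos: "us ! k \<bullet> us ! k > 0" if "k < r" for k
  proof -
    have "us ! k \<bullet> us ! k \<ge> 0" unfolding scalar_prod_eq_sum by (intro sum_nonneg) auto
    moreover have "us ! k \<bullet> us ! k \<noteq> 0" using us(3)[of k k] that us(1) r_def by auto
    ultimately show ?thesis by linarith
  qed
  have N2: "N k * N k = us ! k \<bullet> us ! k" "N k > 0" if "k < r" for k
    using Npos[OF that] by (auto simp: N_def)
  have uc: "u k \<in> carrier_vec n" for k using usc by (auto simp: u_def)
  have orth: "u k \<bullet> u l = (if k = l then 1 else 0)" if "k < r" "l < r" for k l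
  proof -
    have "u k \<bullet> u l = (us ! k \<bullet> us ! l) / (N k * N l)"
      using usc[OF that(1)] usc[OF that(2)] that by (simp add: u_def)
    also have "\<dots> = (if k = l then 1 else 0)"
    proof (cases "k = l")
      case True thus ?thesis unfolding True N2(1)[OF that(2)] using Npos[OF that(2)] by simp
    next
      case False
      hence "us ! k \<bullet> us ! l = 0" using us(3)[of k l] that us(1) r_def by simp
      thus ?thesis using False by simp
    qed
    finally show ?thesis .
  qed
  have Ku: "K *\<^sub>v us ! k = us ! k" if k: "k < r" for k
  proof -
    obtain c where c: "c \<in> carrier_vec m" "us ! k = X *\<^sub>v c" using us(5)[of k] k unfolding us(1) r_def by blast
    have "K *\<^sub>v (X *\<^sub>v c) = (K * X) *\<^sub>v c" using K X c by simp
    thus ?thesis using c KX by simp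
  qed
  have main: "sq_norm (K *\<^sub>v e) = (\<Sum>k<r. (u k \<bullet> e)\<^sup>2)" if e: "e \<in> carrier_vec n" for e
  proof -
    have Ke: "K *\<^sub>v e = X *\<^sub>v (Y *\<^sub>v e)" using X Y e KXY by simp
    obtain c where c: "K *\<^sub>v e = mat_of_cols n us *\<^sub>v vec r c"
      using us(4)[of "Y *\<^sub>v e"] Y e unfolding Ke us(1) r_def by (metis mult_mat_vec_carrier)
    define w where "w = K *\<^sub>v e"
    have wc: "w \<in> carrier_vec n" using K e by (simp add: w_def)
    \<comment> \<open>\<open>w = K e\<close> is the combination of the orthogonal vectors \<open>us\<close> with coefficients \<open>c\<close>.\<close>
    have wi: "w $ i = (\<Sum>k<r. c k * (us ! k) $ i)" if "i < n" for i
      unfolding w_def c using that us(1) r_def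
      by (simp add: scalar_prod_eq_sum mat_of_cols_def mult.commute)
    have wv: "w \<bullet> v = (\<Sum>k<r. c k * (us ! k \<bullet> v))" if v: "v \<in> carrier_vec n" for v
    proof -
      have "w \<bullet> v = (\<Sum>i<n. \<Sum>k<r. c k * ((us ! k) $ i * v $ i))"
        using v by (auto simp: scalar_prod_eq_sum wi sum_distrib_right mult.assoc intro!: sum.cong)
      also have "\<dots> = (\<Sum>k<r. \<Sum>i<n. c k * ((us ! k) $ i * v $ i))" by (rule sum.swap)
      also have "\<dots> = (\<Sum>k<r. c k * (us ! k \<bullet> v))"
        using v by (auto simp: scalar_prod_eq_sum sum_distrib_left)
      finally show ?thesis .
    qed
    have coef: "us ! k \<bullet> w = c k * (us ! k \<bullet> us ! k)" if k: "k < r" for k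
    proof -
      have "us ! k \<bullet> w = w \<bullet> us ! k" by (rule comm_scalar_prod[OF usc[OF k] wc])
      also have "\<dots> = (\<Sum>l<r. c l * (us ! l \<bullet> us ! k))" by (rule wv[OF usc[OF k]])
      also have "\<dots> = (\<Sum>l<r. if l = k then c k * (us ! k \<bullet> us ! k) else 0)"
        using us(3) us(1) k r_def by (intro sum.cong) auto
      also have "\<dots> = c k * (us ! k \<bullet> us ! k)" using k by simp
      finally show ?thesis .
    qed
    have ue: "us ! k \<bullet> w = us ! k \<bullet> e" if k: "k < r" for k
    proof -
      have "us ! k \<bullet> w = (K\<^sup>T *\<^sub>v us ! k) \<bullet> e"
        unfolding w_def by (rule transpose_vec_mult_scalar[OF K e usc[OF k], symmetric])
      also have "\<dots> = us ! k \<bullet> e" by (simp only: sym Ku[OF k])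
      finally show ?thesis .
    qed
    have "sq_norm w = (\<Sum>k<r. c k * (us ! k \<bullet> w))" unfolding sq_norm_def by (rule wv[OF wc])
    also have "\<dots> = (\<Sum>k<r. (u k \<bullet> e)\<^sup>2)"
    proof (rule sum.cong)
      fix k assume "k \<in> {..<r}" hence k: "k < r" by simp
      have "u k \<bullet> e = (us ! k \<bullet> e) / N k" using k usc[OF k] e by (simp add: u_def)
      also have "us ! k \<bullet> e = c k * (N k * N k)" unfolding ue[OF k, symmetric] coef[OF k] N2(1)[OF k] ..
      finally have 1: "u k \<bullet> e = c k * N k" using N2(2)[OF k] by simp
      show "c k * (us ! k \<bullet> w) = (u k \<bullet> e)\<^sup>2" unfolding coef[OF k] 1 N2(1)[OF k, symmetric]
        by (simp add: power2_eq_square)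
    qed simp
    finally show ?thesis by (simp add: w_def)
  qed
  show ?thesis unfolding orthonormal_squares_def using uc orth main r_def by blast
qed

text \<open>
  Both sides are the trace of \<open>K\<^sup>T K\<close>. For complementary projections this turns Pythagoras into an
  equation between ranks.
\<close>
lemma sum_sq_norm_unit_vecs:
  assumes "orthonormal_squares n r K"
  shows "(\<Sum>i<n. sq_norm (K *\<^sub>v unit_vec n i)) = real r"
proof -
  obtain u where u: "\<And>k. u k \<in> carrier_vec n"
    and orth: "\<And>k l. k < r \<Longrightarrow> l < r \<Longrightarrow> u k \<bullet> u l = (if k = l then 1 else 0)"
    and K: "\<And>e. e \<in> carrier_vec n \<Longrightarrow> sq_norm (K *\<^sub>v e) = (\<Sum>k<r. (u k \<bullet> e)\<^sup>2)"
    using assms unfolding orthonormal_squares_def by blast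
  have "(\<Sum>i<n. sq_norm (K *\<^sub>v unit_vec n i)) = (\<Sum>i<n. \<Sum>k<r. (u k $ i)\<^sup>2)"
    by (simp add: K)
  also have "\<dots> = (\<Sum>k<r. \<Sum>i<n. (u k $ i)\<^sup>2)" by (rule sum.swap)
  also have "\<dots> = (\<Sum>k<r. u k \<bullet> u k)"
    using u by (intro sum.cong refl) (auto simp: scalar_prod_eq_sum power2_eq_square carrier_vecD[OF u])
  also have "\<dots> = (\<Sum>k<r. 1)" by (intro sum.cong refl) (simp add: orth)
  finally show ?thesis by simp
qed

section \<open>The smallest eigenvalue bounds a quadratic form\<close>

lemma symmetric_scalar_prod:
  fixes S :: "real mat"
  assumes S: "S \<in> carrier_mat k k" and sym: "S\<^sup>T = S" and v: "v \<in> carrier_vec k" and w: "w \<in> carrier_vec k"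
  shows "v \<bullet> (S *\<^sub>v w) = w \<bullet> (S *\<^sub>v v)"
proof -
  have "v \<bullet> (S *\<^sub>v w) = (S\<^sup>T *\<^sub>v v) \<bullet> w" by (rule transpose_vec_mult_scalar[OF S w v, symmetric])
  also have "\<dots> = w \<bullet> (S *\<^sub>v v)" unfolding sym by (rule comm_scalar_prod[of _ k]) (use S v w in auto)
  finally show ?thesis .
qed

lemma continuous_on_coordinate: "continuous_on A (\<lambda>x :: nat \<Rightarrow> real. x i)"
  by (rule continuous_on_subset[OF continuous_on_product_coordinates]) simp

text \<open>
  The unit sphere is realised as a compact set of functions on \<open>nat\<close> that vanish from \<open>k\<close> on, so that
  compactness comes from Tychonoff's theorem.
\<close>
lemma quadratic_form_attains_min:
  fixes S :: "real mat"
  assumes S: "S \<in> carrier_mat k k" and k: "k > 0"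
  obtains v where "v \<in> carrier_vec k" "sq_norm v = 1"
    "\<And>w. w \<in> carrier_vec k \<Longrightarrow> (v \<bullet> (S *\<^sub>v v)) * sq_norm w \<le> w \<bullet> (S *\<^sub>v w)"
proof -
  define f where "f x = (\<Sum>i<k. \<Sum>j<k. x i * (S $$ (i, j) * x j))" for x :: "nat \<Rightarrow> real"
  have f: "vec k x \<bullet> (S *\<^sub>v vec k x) = f x" for x
    using S by (simp add: scalar_prod_eq_sum f_def sum_distrib_left)
  define B where "B i = (if i < k then {-1..1} else {0::real})" for i
  define K where "K = PiE UNIV B \<inter> {x. (\<Sum>i<k. (x i)\<^sup>2) = 1}"
  have "compactin (product_topology (\<lambda>_. euclidean) UNIV) (PiE UNIV B)"
    unfolding compactin_PiE by (auto simp: B_def)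
  hence "compact (PiE UNIV B)" unfolding euclidean_product_topology by simp
  moreover have "closed {x :: nat \<Rightarrow> real. (\<Sum>i<k. (x i)\<^sup>2) = 1}"
    by (intro closed_Collect_eq continuous_intros continuous_on_coordinate)
  ultimately have "compact K" unfolding K_def by (rule compact_Int_closed)
  moreover have "(\<lambda>i. if i = 0 then 1 else 0) \<in> K"
  proof -
    have "(\<Sum>i<k. (if i = 0 then 1 else 0 :: real)\<^sup>2) = (\<Sum>i<k. if i = 0 then 1 else 0)"
      by (intro sum.cong) auto
    thus ?thesis using k by (auto simp: K_def B_def)
  qed
  moreover have "continuous_on K f"
    unfolding f_def by (intro continuous_intros continuous_on_coordinate)
  ultimately obtain x where x: "x \<in> K" "\<And>y. y \<in> K \<Longrightarrow> f x \<le> f y"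
    using continuous_attains_inf[of K f] by blast
  show ?thesis
  proof (rule that[of "vec k x"])
    show "sq_norm (vec k x) = 1" using x(1) by (simp add: sq_norm_eq_sum K_def)
    fix w :: "real vec" assume w: "w \<in> carrier_vec k"
    show "(vec k x \<bullet> (S *\<^sub>v vec k x)) * sq_norm w \<le> w \<bullet> (S *\<^sub>v w)"
    proof (cases "w = 0\<^sub>v k")
      case True
      thus ?thesis using S sq_norm_eq_0_iff[OF w] by simp
    next
      case False
      define c where "c = sqrt (sq_norm w)"
      have pos: "sq_norm w > 0" using False sq_norm_eq_0_iff[OF w] sq_norm_nonneg[of w] by linarith
      have c: "c > 0" "c * c = sq_norm w" using pos by (auto simp: c_def)
      define y where "y i = (if i < k then w $ i / c else 0)" for i
      have yw: "vec k y = (1 / c) \<cdot>\<^sub>v w" using w by (intro eq_vecI) (auto simp: y_def)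
      have y1: "(\<Sum>i<k. (y i)\<^sup>2) = 1"
        using w c pos by (simp add: y_def sq_norm_eq_sum power_divide sum_divide_distrib[symmetric]
          power2_eq_square[of c])
      have "y i \<in> B i" for i
      proof (cases "i < k")
        case True
        have "(y i)\<^sup>2 \<le> (\<Sum>i<k. (y i)\<^sup>2)" using True by (intro member_le_sum) auto
        hence "\<bar>y i\<bar> \<le> 1" unfolding y1 by (simp add: abs_square_le_1)
        thus ?thesis using True by (auto simp: B_def)
      qed (auto simp: B_def y_def)
      hence "y \<in> K" using y1 by (auto simp: K_def)
      hence "f x \<le> f y" by (rule x(2))
      also have "f y = (w \<bullet> (S *\<^sub>v w)) / (c * c)"
        unfolding f[symmetric] yw using S w mult_mat_vec[OF S w, of "1 / c"] by simp
      finally show ?thesis using pos unfolding f c(2) by (simp add: field_simps)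
    qed
  qed simp
qed

lemma linear_term_zero_if_quadratic_nonneg:
  fixes b q :: real
  assumes "\<And>t. 0 \<le> 2 * t * b + t\<^sup>2 * q" and "q \<ge> 0"
  shows "b = 0"
proof -
  \<comment> \<open>A step against the sign of \<open>b\<close>, short enough for the linear term to dominate.\<close>
  have "0 \<le> 2 * (- b / (q + 1)) * b + (- b / (q + 1))\<^sup>2 * q" by (rule assms(1))
  also have "\<dots> = - (b\<^sup>2 * (q + 2)) / (q + 1)\<^sup>2"
    using assms(2) by (simp add: power2_eq_square divide_simps) (simp add: algebra_simps)
  finally have "b\<^sup>2 * (q + 2) / (q + 1)\<^sup>2 \<le> 0" by simp
  hence "b\<^sup>2 * (q + 2) \<le> 0" using assms(2) by (simp add: divide_le_0_iff)
  hence "b\<^sup>2 \<le> 0" using assms(2) by (simp add: mult_le_0_iff)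
  thus ?thesis by simp
qed

text \<open>
  Let \<open>m\<close> be the minimum of the form on the unit sphere, attained at \<open>v\<close>. The form
  \<open>w \<bullet> S w - m |w|\<^sup>2\<close> is nonnegative and vanishes at \<open>v\<close>, so its derivative there is zero in every
  direction, that is \<open>S v = m v\<close>. Thus \<open>m\<close> is an eigenvalue, and \<open>lambda_min S \<le> m\<close>.
\<close>
lemma lambda_min_le_quadratic_form:
  fixes S :: "real mat"
  assumes S: "S \<in> carrier_mat k k" and sym: "S\<^sup>T = S" and k: "k > 0" and w: "w \<in> carrier_vec k"
  shows "lambda_min S * sq_norm w \<le> w \<bullet> (S *\<^sub>v w)"
proof -
  obtain v where v: "v \<in> carrier_vec k" "sq_norm v = 1"
    and min: "\<And>w. w \<in> carrier_vec k \<Longrightarrow> (v \<bullet> (S *\<^sub>v v)) * sq_norm w \<le> w \<bullet> (S *\<^sub>v w)"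
    by (rule quadratic_form_attains_min[OF S k]) blast
  define m where "m = v \<bullet> (S *\<^sub>v v)"
  have Sc: "S *\<^sub>v x \<in> carrier_vec k" if "x \<in> carrier_vec k" for x using S that by simp
  \<comment> \<open>Half of the derivative at \<open>v\<close> in direction \<open>u\<close> of the form minus \<open>m\<close> times the squared norm.\<close>
  have crit: "u \<bullet> (S *\<^sub>v v) - m * (u \<bullet> v) = 0" if u: "u \<in> carrier_vec k" for u
  proof (rule linear_term_zero_if_quadratic_nonneg)
    show "0 \<le> u \<bullet> (S *\<^sub>v u) - m * sq_norm u" using min[OF u] by (simp add: m_def)
    fix t :: real
    have tu: "t \<cdot>\<^sub>v u \<in> carrier_vec k" using u by simp
    have Sv: "S *\<^sub>v (v + t \<cdot>\<^sub>v u) = S *\<^sub>v v + t \<cdot>\<^sub>v (S *\<^sub>v u)"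
      using mult_add_distrib_mat_vec[OF S v(1) tu] mult_mat_vec[OF S u] by simp
    have e1: "(v + t \<cdot>\<^sub>v u) \<bullet> (S *\<^sub>v (v + t \<cdot>\<^sub>v u))
        = m + 2 * t * (u \<bullet> (S *\<^sub>v v)) + t\<^sup>2 * (u \<bullet> (S *\<^sub>v u))"
      unfolding Sv using v(1) u tu Sc[OF v(1)] Sc[OF u] symmetric_scalar_prod[OF S sym v(1) u]
      by (simp add: add_scalar_prod_distrib[of _ k] scalar_prod_add_distrib[of _ k] m_def
          power2_eq_square algebra_simps)
    have e2: "sq_norm (v + t \<cdot>\<^sub>v u) = 1 + 2 * t * (u \<bullet> v) + t\<^sup>2 * sq_norm u"
      unfolding sq_norm_def v(2)[unfolded sq_norm_def, symmetric]
      using v(1) u tu comm_scalar_prod[OF v(1) u]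
      by (simp add: add_scalar_prod_distrib[of _ k] scalar_prod_add_distrib[of _ k]
          power2_eq_square algebra_simps)
    have "m * sq_norm (v + t \<cdot>\<^sub>v u) \<le> (v + t \<cdot>\<^sub>v u) \<bullet> (S *\<^sub>v (v + t \<cdot>\<^sub>v u))"
      unfolding m_def using v(1) tu by (intro min) simp
    thus "0 \<le> 2 * t * (u \<bullet> (S *\<^sub>v v) - m * (u \<bullet> v)) + t\<^sup>2 * (u \<bullet> (S *\<^sub>v u) - m * sq_norm u)"
      unfolding e1 e2 by (simp add: algebra_simps)
  qed
  have "S *\<^sub>v v = m \<cdot>\<^sub>v v"
  proof -
    define d where "d = S *\<^sub>v v - m \<cdot>\<^sub>v v"
    have dc: "d \<in> carrier_vec k" using v(1) Sc by (simp add: d_def)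
    have "d \<bullet> (S *\<^sub>v v - m \<cdot>\<^sub>v v) = d \<bullet> (S *\<^sub>v v) - d \<bullet> (m \<cdot>\<^sub>v v)"
      by (rule scalar_prod_minus_distrib[of _ k]) (use dc Sc v(1) in auto)
    hence "sq_norm d = 0" using crit[OF dc] dc v(1) by (simp add: sq_norm_def d_def[symmetric])
    hence "d = 0\<^sub>v k" using sq_norm_eq_0_iff[OF dc] by simp
    hence "d $ i = 0" if "i < k" for i using that by simp
    thus ?thesis using Sc[OF v(1)] v(1) S by (intro eq_vecI) (auto simp: d_def)
  qed
  moreover have "v \<noteq> 0\<^sub>v k" using v(2) sq_norm_eq_0_iff[OF v(1)] by auto
  ultimately have "eigenvalue S m"
    unfolding eigenvalue_def eigenvector_def using S v(1) by auto
  hence "m \<in> spectrum S" by (simp add: spectrum_def)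
  hence "lambda_min S \<le> m"
    unfolding lambda_min_def using card_finite_spectrum(1)[OF S] by (rule Min_le[rotated])
  hence "lambda_min S * sq_norm w \<le> m * sq_norm w" by (rule mult_right_mono) (rule sq_norm_nonneg)
  also have "\<dots> \<le> w \<bullet> (S *\<^sub>v w)" unfolding m_def by (rule min[OF w])
  finally show ?thesis .
qed

section \<open>Orthogonal projections from generalized inverses\<close>

lemma mat_eq_if_mult_vec_eq:
  fixes A :: "real mat"
  assumes A: "A \<in> carrier_mat n m" and B: "B \<in> carrier_mat n m"
    and eq: "\<And>w. w \<in> carrier_vec m \<Longrightarrow> A *\<^sub>v w = B *\<^sub>v w"
  shows "A = B"
proof (rule eq_matI)
  fix i j assume ij: "i < dim_row B" "j < dim_col B"
  have "(A *\<^sub>v unit_vec m j) $ i = (B *\<^sub>v unit_vec m j) $ i" using eq[of "unit_vec m j"] by simp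
  thus "A $$ (i, j) = B $$ (i, j)" using A B ij by simp
qed (use A B in auto)

text \<open>
  The defining equation of \<open>G\<close> says that \<open>W\<^sup>T W z = 0\<close> for \<open>z = G W\<^sup>T W w - w\<close>. Then
  \<open>|W z|\<^sup>2 = W\<^sup>T W z \<bullet> z = 0\<close>, so \<open>W z = 0\<close>, which is the claim at \<open>w\<close>.
\<close>
lemma generalized_inverse_projection_fixes_columns:
  fixes W G :: "real mat"
  assumes W: "W \<in> carrier_mat n m" and g: "is_generalized_inverse (W\<^sup>T * W) G"
  shows "W * G * W\<^sup>T * W = W"
proof (rule mat_eq_if_mult_vec_eq)
  have G: "G \<in> carrier_mat m m" and WW: "W\<^sup>T * W * G * (W\<^sup>T * W) = W\<^sup>T * W"
    using g W unfolding is_generalized_inverse_def by auto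
  have T: "W\<^sup>T \<in> carrier_mat m n" using W by simp
  have Q: "W\<^sup>T * W \<in> carrier_mat m m" using W T by simp
  show "W * G * W\<^sup>T * W \<in> carrier_mat n m" "W \<in> carrier_mat n m" using W G T by auto
  fix w :: "real vec" assume w: "w \<in> carrier_vec m"
  define z where "z = G *\<^sub>v ((W\<^sup>T * W) *\<^sub>v w) - w"
  have gw: "G *\<^sub>v ((W\<^sup>T * W) *\<^sub>v w) \<in> carrier_vec m" using G Q w by (metis mult_mat_vec_carrier)
  have z: "z \<in> carrier_vec m" unfolding z_def using gw w by simp
  have "(W\<^sup>T * W) *\<^sub>v z = (W\<^sup>T * W * G * (W\<^sup>T * W)) *\<^sub>v w - (W\<^sup>T * W) *\<^sub>v w"
    unfolding z_def mult_minus_distrib_mat_vec[OF Q gw w]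
    using assoc_mult_mat_vec[OF Q G, of "(W\<^sup>T * W) *\<^sub>v w"]
      assoc_mult_mat_vec[OF mult_carrier_mat[OF Q G] Q w] Q w by simp
  hence "(W\<^sup>T * W) *\<^sub>v z = 0\<^sub>v m" unfolding WW using Q w by simp
  hence "W\<^sup>T *\<^sub>v (W *\<^sub>v z) = 0\<^sub>v m" using assoc_mult_mat_vec[OF T W z] by simp
  hence "sq_norm (W *\<^sub>v z) = 0"
    unfolding sq_norm_def using transpose_vec_mult_scalar[OF W z, of "W *\<^sub>v z"] W z by simp
  hence "W *\<^sub>v z = 0\<^sub>v n" using sq_norm_eq_0_iff[of "W *\<^sub>v z" n] W z by simp
  hence d: "W *\<^sub>v (G *\<^sub>v ((W\<^sup>T * W) *\<^sub>v w)) - W *\<^sub>v w = 0\<^sub>v n"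
    unfolding z_def using mult_minus_distrib_mat_vec[OF W gw w] by simp
  have "W * G * W\<^sup>T * W = W * G * (W\<^sup>T * W)" using W G T by (intro assoc_mult_mat[of _ n m _ n]) auto
  hence e: "(W * G * W\<^sup>T * W) *\<^sub>v w = W *\<^sub>v (G *\<^sub>v ((W\<^sup>T * W) *\<^sub>v w))"
    using assoc_mult_mat_vec[OF mult_carrier_mat[OF W G] Q w] assoc_mult_mat_vec[OF W G, of "(W\<^sup>T * W) *\<^sub>v w"] Q w
    by simp
  show "(W * G * W\<^sup>T * W) *\<^sub>v w = W *\<^sub>v w"
    unfolding e
  proof (rule eq_vecI)
    fix i assume i: "i < dim_vec (W *\<^sub>v w)"
    hence "(W *\<^sub>v (G *\<^sub>v ((W\<^sup>T * W) *\<^sub>v w)) - W *\<^sub>v w) $ i = 0" unfolding d using W by simp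
    thus "(W *\<^sub>v (G *\<^sub>v ((W\<^sup>T * W) *\<^sub>v w))) $ i = (W *\<^sub>v w) $ i" using i W by simp
  qed (use W in simp)
qed

locale column_projection =
  fixes W G K H :: "real mat" and n m :: nat
  assumes W: "W \<in> carrier_mat n m" and ginverse: "is_generalized_inverse (W\<^sup>T * W) G"
  defines "K \<equiv> W * G * W\<^sup>T" and "H \<equiv> 1\<^sub>m n - K"
begin

lemma G: "G \<in> carrier_mat m m"
  using ginverse W unfolding is_generalized_inverse_def by auto

lemma K: "K \<in> carrier_mat n n" using W G by (auto simp: K_def)

lemma H: "H \<in> carrier_mat n n" using K by (auto simp: H_def)

lemma K_mult_W: "K * W = W"
  unfolding K_def by (rule generalized_inverse_projection_fixes_columns[OF W ginverse])

text \<open>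
  A generalized inverse of a symmetric matrix need not be symmetric. Still, transposing \<open>K W = W\<close> gives
  \<open>W\<^sup>T K\<^sup>T = W\<^sup>T\<close>, hence \<open>K K\<^sup>T = W G W\<^sup>T K\<^sup>T = K\<close>, and the left-hand side is symmetric.
\<close>
lemma K_sym: "K\<^sup>T = K" and K_idem: "K * K = K"
proof -
  have T: "W\<^sup>T \<in> carrier_mat m n" "K\<^sup>T \<in> carrier_mat n n" using W K by simp_all
  have "W\<^sup>T * K\<^sup>T = W\<^sup>T" using transpose_mult[OF K W] K_mult_W by simp
  hence KK: "K * K\<^sup>T = K"
    using assoc_mult_mat[OF mult_carrier_mat[OF W G] T(1) T(2)] by (simp add: K_def)
  have "(K * K\<^sup>T)\<^sup>T = K * K\<^sup>T" using transpose_mult[OF K T(2)] by simp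
  thus sym: "K\<^sup>T = K" unfolding KK .
  show "K * K = K" using KK unfolding sym .
qed

lemma H_vec: "e \<in> carrier_vec n \<Longrightarrow> H *\<^sub>v e = e - K *\<^sub>v e"
  unfolding H_def using minus_mult_distrib_mat_vec[OF one_carrier_mat K] by simp

lemma K_vec_idem: "e \<in> carrier_vec n \<Longrightarrow> K *\<^sub>v (K *\<^sub>v e) = K *\<^sub>v e"
  using assoc_mult_mat_vec[OF K K] K_idem by metis

lemma H_sym: "H\<^sup>T = H"
  unfolding H_def using K transpose_minus[OF one_carrier_mat K] K_sym by simp

lemma H_vec_idem: assumes e: "e \<in> carrier_vec n" shows "H *\<^sub>v (H *\<^sub>v e) = H *\<^sub>v e"
proof -
  have Ke: "K *\<^sub>v e \<in> carrier_vec n" using K e by simp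
  have "K *\<^sub>v (H *\<^sub>v e) = K *\<^sub>v e - K *\<^sub>v (K *\<^sub>v e)"
    unfolding H_vec[OF e] by (rule mult_minus_distrib_mat_vec[OF K e Ke])
  also have "\<dots> = 0\<^sub>v n" unfolding K_vec_idem[OF e] using Ke by simp
  finally show ?thesis using H_vec[of "H *\<^sub>v e"] H e by simp
qed

lemma H_idem: "H * H = H"
proof (rule mat_eq_if_mult_vec_eq)
  fix w :: "real vec" assume w: "w \<in> carrier_vec n"
  show "(H * H) *\<^sub>v w = H *\<^sub>v w" using assoc_mult_mat_vec[OF H H w] H_vec_idem[OF w] by simp
qed (use H in auto)

lemma H_W_vec: assumes w: "w \<in> carrier_vec m" shows "H *\<^sub>v (W *\<^sub>v w) = 0\<^sub>v n"
proof -
  have "K *\<^sub>v (W *\<^sub>v w) = W *\<^sub>v w" using assoc_mult_mat_vec[OF K W w] K_mult_W by simp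
  thus ?thesis using H_vec[of "W *\<^sub>v w"] W w by simp
qed

lemma sq_norm_K: "e \<in> carrier_vec n \<Longrightarrow> sq_norm (K *\<^sub>v e) = e \<bullet> (K *\<^sub>v e)"
  unfolding sq_norm_def using symmetric_scalar_prod[OF K K_sym, of "K *\<^sub>v e" e] K K_vec_idem by simp

lemma sq_norm_H: "e \<in> carrier_vec n \<Longrightarrow> sq_norm (H *\<^sub>v e) = e \<bullet> (H *\<^sub>v e)"
  unfolding sq_norm_def using symmetric_scalar_prod[OF H H_sym, of "H *\<^sub>v e" e] H H_vec_idem by simp

lemma pythagoras: assumes e: "e \<in> carrier_vec n"
  shows "sq_norm (H *\<^sub>v e) + sq_norm (K *\<^sub>v e) = sq_norm e"
proof -
  have "e \<bullet> (e - K *\<^sub>v e) = e \<bullet> e - e \<bullet> (K *\<^sub>v e)"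
    by (rule scalar_prod_minus_distrib[of _ n]) (use e K in auto)
  thus ?thesis unfolding sq_norm_K[OF e] sq_norm_H[OF e] unfolding H_vec[OF e] sq_norm_def by simp
qed

lemma sq_norm_H_add: assumes x: "x \<in> carrier_vec n" and e: "e \<in> carrier_vec n"
  shows "sq_norm (H *\<^sub>v (x + e)) = sq_norm (H *\<^sub>v x) + 2 * ((H *\<^sub>v x) \<bullet> e) + sq_norm (H *\<^sub>v e)"
proof -
  have Hx: "H *\<^sub>v x \<in> carrier_vec n" and He: "H *\<^sub>v e \<in> carrier_vec n" using H x e by auto
  have 1: "(H *\<^sub>v x) \<bullet> (H *\<^sub>v e) = (H *\<^sub>v x) \<bullet> e"
    using symmetric_scalar_prod[OF H H_sym Hx e] H_vec_idem[OF x] comm_scalar_prod[OF e Hx] by simp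
  show ?thesis
    unfolding sq_norm_def mult_add_distrib_mat_vec[OF H x e]
    using Hx He 1 comm_scalar_prod[OF He Hx]
    by (simp add: add_scalar_prod_distrib[of _ n] scalar_prod_add_distrib[of _ n])
qed

lemma K_squares: "orthonormal_squares n (vec_space.rank n W) K"
proof -
  have "G * W\<^sup>T \<in> carrier_mat m n" and "K = W * (G * W\<^sup>T)"
    using G W assoc_mult_mat[OF W G, of "W\<^sup>T" n] by (auto simp: K_def)
  from orthogonal_projection_sum_of_squares[OF K K_sym W K_mult_W this] show ?thesis .
qed

lemma H_squares: "orthonormal_squares n (vec_space.rank n H) H"
  by (rule orthogonal_projection_sum_of_squares[OF H H_sym H H_idem H H_idem[symmetric]])

lemma rank_complement: "vec_space.rank n H + vec_space.rank n W = n"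
proof -
  have "real (vec_space.rank n H) + real (vec_space.rank n W)
      = (\<Sum>i<n. sq_norm (H *\<^sub>v unit_vec n i)) + (\<Sum>i<n. sq_norm (K *\<^sub>v unit_vec n i))"
    unfolding sum_sq_norm_unit_vecs[OF H_squares] sum_sq_norm_unit_vecs[OF K_squares] ..
  also have "\<dots> = (\<Sum>i<n. sq_norm (unit_vec n i))"
    unfolding sum.distrib[symmetric] by (intro sum.cong refl pythagoras) simp
  also have "\<dots> = real n" by (simp add: sq_norm_def)
  finally show ?thesis by linarith
qed

end

section \<open>Residual sums of squares of submodels\<close>

lemma bij_betw_pick: assumes "finite A" shows "bij_betw (pick A) {..<card A} A"
proof -
  have "inj_on (pick A) {..<card A}"
    by (rule strict_mono_on_imp_inj_on) (auto intro!: strict_mono_onI pick_mono_le)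
  moreover have "pick A ` {..<card A} \<subseteq> A" by (auto intro: pick_in_set_le)
  ultimately show ?thesis
    unfolding bij_betw_def using assms by (metis card_image card_lessThan card_subset_eq)
qed

lemma submat_cols_carrier:
  assumes X: "X \<in> carrier_mat n p" and A: "A \<subseteq> {..<p}"
  shows "submat_cols X A \<in> carrier_mat n (card A)"
proof -
  have "{j. j < p \<and> j \<in> A} = A" using A by auto
  thus ?thesis using X by (intro carrier_matI) (auto simp: submat_cols_def dim_submatrix)
qed

lemma submat_cols_mult_pick:
  assumes X: "X \<in> carrier_mat n p" and A: "A \<subseteq> {..<p}" and i: "i < n"
  shows "(submat_cols X A *\<^sub>v vec (card A) (\<lambda>k. \<beta> $ pick A k)) $ i = (\<Sum>j\<in>A. X $$ (i, j) * \<beta> $ j)"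
proof -
  have S: "submat_cols X A \<in> carrier_mat n (card A)" by (rule submat_cols_carrier[OF X A])
  have fin: "finite A" using A finite_subset by blast
  have eqA: "{j. j < p \<and> j \<in> A} = A" using A by auto
  have ent: "submat_cols X A $$ (i, k) = X $$ (i, pick A k)" if "k < card A" for k
    unfolding submat_cols_def using that i X eqA by (subst submatrix_index) (auto simp: pick_UNIV)
  have "(submat_cols X A *\<^sub>v vec (card A) (\<lambda>k. \<beta> $ pick A k)) $ i
      = (\<Sum>k<card A. X $$ (i, pick A k) * \<beta> $ pick A k)"
    using S i by (simp add: scalar_prod_eq_sum ent)
  also have "\<dots> = (\<Sum>j\<in>A. X $$ (i, j) * \<beta> $ j)"
    by (rule sum.reindex_bij_betw[OF bij_betw_pick[OF fin]])
  finally show ?thesis .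
qed

text \<open>
  The summands outside \<open>A \<union> D\<close> vanish, because all nonzero coefficients lie in the true submodel.
\<close>
lemma mult_mat_vec_split_submodel:
  assumes X: "X \<in> carrier_mat n p" and \<beta>: "\<beta> \<in> carrier_vec p" and A: "A \<subseteq> {..<p}"
    and D: "D = true_submodel \<beta> - A"
  shows "X *\<^sub>v \<beta> = submat_cols X A *\<^sub>v vec (card A) (\<lambda>k. \<beta> $ pick A k)
    + submat_cols X D *\<^sub>v vec (card D) (\<lambda>k. \<beta> $ pick D k)"
proof (rule eq_vecI)
  have Dp: "D \<subseteq> {..<p}" using \<beta> by (auto simp: D true_submodel_def)
  note S = submat_cols_carrier[OF X A] submat_cols_carrier[OF X Dp]
  show "dim_vec (X *\<^sub>v \<beta>) = dim_vec (submat_cols X A *\<^sub>v vec (card A) (\<lambda>k. \<beta> $ pick A k)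
    + submat_cols X D *\<^sub>v vec (card D) (\<lambda>k. \<beta> $ pick D k))" using X S by simp
  fix i assume "i < dim_vec (submat_cols X A *\<^sub>v vec (card A) (\<lambda>k. \<beta> $ pick A k)
    + submat_cols X D *\<^sub>v vec (card D) (\<lambda>k. \<beta> $ pick D k))"
  hence i: "i < n" using S by simp
  have fin: "finite A" "finite D" using A Dp finite_subset by blast+
  have "(X *\<^sub>v \<beta>) $ i = (\<Sum>j<p. X $$ (i, j) * \<beta> $ j)"
    using X \<beta> i by (simp add: scalar_prod_eq_sum)
  also have "\<dots> = (\<Sum>j\<in>A \<union> D. X $$ (i, j) * \<beta> $ j)"
    using A Dp \<beta> by (intro sum.mono_neutral_right) (auto simp: D true_submodel_def)
  also have "\<dots> = (\<Sum>j\<in>A. X $$ (i, j) * \<beta> $ j) + (\<Sum>j\<in>D. X $$ (i, j) * \<beta> $ j)"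
    using fin by (intro sum.union_disjoint) (auto simp: D)
  also have "\<dots> = (submat_cols X A *\<^sub>v vec (card A) (\<lambda>k. \<beta> $ pick A k)
    + submat_cols X D *\<^sub>v vec (card D) (\<lambda>k. \<beta> $ pick D k)) $ i"
    using S i submat_cols_mult_pick[OF X A i] submat_cols_mult_pick[OF X Dp i] by simp
  finally show "(X *\<^sub>v \<beta>) $ i = (submat_cols X A *\<^sub>v vec (card A) (\<lambda>k. \<beta> $ pick A k)
    + submat_cols X D *\<^sub>v vec (card D) (\<lambda>k. \<beta> $ pick D k)) $ i" .
qed

lemma beta_min_sq_le:
  assumes D: "D \<subseteq> true_submodel \<beta>" "D \<noteq> {}"
  shows "(beta_min \<beta>)\<^sup>2 \<le> sq_norm (vec (card D) (\<lambda>k. \<beta> $ pick D k))"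
proof -
  have fin0: "finite (true_submodel \<beta>)" by (simp add: true_submodel_def)
  hence fin: "finite D" using D(1) finite_subset by blast
  obtain j where j: "j \<in> D" using D(2) by blast
  have "\<bar>beta_min \<beta>\<bar> \<le> \<bar>\<beta> $ j\<bar>"
    unfolding beta_min_def using j D(1) by (intro arg_min_least[OF fin0]) auto
  hence "(beta_min \<beta>)\<^sup>2 \<le> (\<beta> $ j)\<^sup>2" by (simp add: abs_le_square_iff)
  also have "\<dots> \<le> (\<Sum>j\<in>D. (\<beta> $ j)\<^sup>2)" using j fin by (intro member_le_sum) auto
  also have "\<dots> = (\<Sum>k<card D. (\<beta> $ pick D k)\<^sup>2)"
    by (rule sum.reindex_bij_betw[OF bij_betw_pick[OF fin], symmetric])
  finally show ?thesis by (simp add: sq_norm_eq_sum)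
qed

locale submodel_regression =
  fixes ginv :: "real mat \<Rightarrow> real mat" and X :: "real mat" and \<beta> :: "real vec" and n p :: nat and A :: "nat set"
  assumes X: "X \<in> carrier_mat n p" and \<beta>: "\<beta> \<in> carrier_vec p"
    and ginv: "\<And>A. is_generalized_inverse A (ginv A)" and A: "A \<subseteq> {..<p}"
begin

abbreviation "W \<equiv> submat_cols X A"
abbreviation "G \<equiv> ginv (W\<^sup>T * W)"
abbreviation "K \<equiv> W * G * W\<^sup>T"
abbreviation "H \<equiv> H_mat ginv X A"

lemma W: "W \<in> carrier_mat n (card A)" by (rule submat_cols_carrier[OF X A])

lemma H_eq: "H = 1\<^sub>m n - K" using X by (simp add: H_mat_def Let_def)

sublocale P: column_projection W G K H n "card A"
  by unfold_locales (use W ginv H_eq in \<open>auto simp: carrier_matD\<close>)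

lemma rss_eq: assumes y: "y \<in> carrier_vec n" shows "rss ginv X y A = sq_norm (H *\<^sub>v y)"
proof -
  have T: "G * W\<^sup>T \<in> carrier_mat (card A) n" using W P.G by simp
  have "W *\<^sub>v ((G * W\<^sup>T) *\<^sub>v y) = K *\<^sub>v y"
    using assoc_mult_mat_vec[OF W T y] assoc_mult_mat[OF W P.G, of "W\<^sup>T" n] W by simp
  thus ?thesis unfolding rss_def beta_hat_def Let_def using P.H_vec[OF y] by simp
qed

text \<open>
  \<open>D\<close> is the set of true predictors that the submodel \<open>A\<close> misses, \<open>w\<close> is the vector of their
  coefficients, and \<open>v\<close> is the part of the mean response that \<open>A\<close> cannot explain.
\<close>
definition "D = true_submodel \<beta> - A"
definition "w = vec (card D) (\<lambda>k. \<beta> $ pick D k)"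
abbreviation "Z \<equiv> submat_cols X D"
definition "v = H *\<^sub>v (X *\<^sub>v \<beta>)"

lemma D: "D \<subseteq> {..<p}" using \<beta> by (auto simp: D_def true_submodel_def)

lemma Z: "Z \<in> carrier_mat n (card D)" by (rule submat_cols_carrier[OF X D])

lemma w: "w \<in> carrier_vec (card D)" by (simp add: w_def)

lemma v: "v \<in> carrier_vec n" using P.H X \<beta> by (simp add: v_def)

text \<open>
  The columns of \<open>A\<close> are annihilated by \<open>H\<close>, so only the missed predictors contribute to \<open>v\<close>.
\<close>
lemma v_eq: "v = H *\<^sub>v (Z *\<^sub>v w)"
proof -
  define a where "a = vec (card A) (\<lambda>k. \<beta> $ pick A k)"
  have a: "a \<in> carrier_vec (card A)" by (simp add: a_def)
  have Zw: "Z *\<^sub>v w \<in> carrier_vec n" using Z w by simp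
  have "X *\<^sub>v \<beta> = W *\<^sub>v a + Z *\<^sub>v w"
    unfolding a_def w_def by (rule mult_mat_vec_split_submodel[OF X \<beta> A D_def])
  hence "v = H *\<^sub>v (W *\<^sub>v a) + H *\<^sub>v (Z *\<^sub>v w)"
    unfolding v_def using mult_add_distrib_mat_vec[OF P.H _ Zw, of "W *\<^sub>v a"] W a by simp
  thus ?thesis unfolding P.H_W_vec[OF a] using P.H Zw by simp
qed

lemma rss_response:
  "rss ginv X (response X \<beta> e) A
    = sq_norm v + 2 * (v \<bullet> vec n e) + sq_norm (H *\<^sub>v vec n e)"
proof -
  have Xb: "X *\<^sub>v \<beta> \<in> carrier_vec n" using X \<beta> by simp
  have r: "response X \<beta> e = X *\<^sub>v \<beta> + vec n e" using X by (simp add: response_def)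
  show ?thesis unfolding r using rss_eq[of "X *\<^sub>v \<beta> + vec n e"] P.sq_norm_H_add[OF Xb, of "vec n e"] Xb
    by (simp add: v_def)
qed

lemma v_eq_0: "true_submodel \<beta> \<subseteq> A \<Longrightarrow> v = 0\<^sub>v n"
proof -
  assume "true_submodel \<beta> \<subseteq> A"
  hence "card D = 0" by (simp add: D_def Diff_eq_empty_iff[THEN iffD2])
  hence "Z *\<^sub>v w = 0\<^sub>v n" using Z w by (intro eq_vecI) (auto simp: scalar_prod_def)
  thus ?thesis unfolding v_eq using P.H by (intro eq_vecI) auto
qed

text \<open>
  Since \<open>v = H Z w\<close> and \<open>H\<close> is an orthogonal projection, \<open>|v|\<^sup>2 = w \<bullet> (Z\<^sup>T H Z) w\<close>.
\<close>
lemma lambda_min_le_sq_norm_v: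
  assumes "D \<noteq> {}"
  shows "lambda_min (Z\<^sup>T * H * Z) * sq_norm w \<le> sq_norm v"
proof -
  have ZT: "Z\<^sup>T \<in> carrier_mat (card D) n" using Z by simp
  have Zw: "Z *\<^sub>v w \<in> carrier_vec n" using Z w by simp
  have S: "Z\<^sup>T * H * Z \<in> carrier_mat (card D) (card D)" using ZT P.H Z by simp
  have sym: "(Z\<^sup>T * H * Z)\<^sup>T = Z\<^sup>T * H * Z"
    using transpose_mult[OF mult_carrier_mat[OF ZT P.H] Z] transpose_mult[OF ZT P.H] P.H_sym
      assoc_mult_mat[OF ZT P.H Z] by simp
  have pos: "card D > 0" using assms D finite_subset by (simp add: card_gt_0_iff) blast
  have "(Z\<^sup>T * H * Z) *\<^sub>v w = Z\<^sup>T *\<^sub>v v"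
    using assoc_mult_mat_vec[OF mult_carrier_mat[OF ZT P.H] Z w] assoc_mult_mat_vec[OF ZT P.H Zw] v_eq by simp
  hence "w \<bullet> ((Z\<^sup>T * H * Z) *\<^sub>v w) = (Z\<^sup>T *\<^sub>v v) \<bullet> w"
    using comm_scalar_prod[OF w, of "Z\<^sup>T *\<^sub>v v"] ZT v by simp
  also have "\<dots> = v \<bullet> (Z *\<^sub>v w)" by (rule transpose_vec_mult_scalar[OF Z w v])
  also have "\<dots> = sq_norm v"
    using P.sq_norm_H[OF Zw] comm_scalar_prod[OF v Zw] by (simp add: v_eq[symmetric])
  finally show ?thesis using lambda_min_le_quadratic_form[OF S sym pos w] by simp
qed

text \<open>
  The minimum in \<open>\<delta>\<close> ranges over all bad submodels, so it is at most the entry of \<open>A\<close>, and the missed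
  coefficients contain at least one of absolute value at least \<open>|beta_min|\<close>. If \<open>\<delta> < 0\<close>, the bound
  is trivial.
\<close>
lemma delta_beta_min_le_sq_norm_v:
  assumes bad: "A \<in> bad_submodels \<beta> M" and n: "n > 0"
  shows "real n * delta ginv X \<beta> M * (beta_min \<beta>)\<^sup>2 \<le> sq_norm v"
proof (cases "delta ginv X \<beta> M \<ge> 0")
  case True
  have Dne: "D \<noteq> {}" and Dsub: "D \<subseteq> true_submodel \<beta>"
    using bad by (auto simp: D_def bad_submodels_def good_submodels_def)
  have "finite (bad_submodels \<beta> M)"
    by (rule finite_subset[of _ "Pow {..<dim_vec \<beta>}"]) (auto simp: bad_submodels_def submodels_def)
  hence "delta ginv X \<beta> M \<le> 1 / real n * lambda_min (Z\<^sup>T * H * Z)"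
    unfolding delta_def Let_def D_def using X by (intro Min_le) (use bad in auto)
  hence "real n * delta ginv X \<beta> M \<le> lambda_min (Z\<^sup>T * H * Z)"
    using n by (simp add: field_simps)
  moreover have "real n * delta ginv X \<beta> M * (beta_min \<beta>)\<^sup>2 \<le> real n * delta ginv X \<beta> M * sq_norm w"
    unfolding w_def using beta_min_sq_le[OF Dsub Dne] True by (intro mult_left_mono) auto
  ultimately have "real n * delta ginv X \<beta> M * (beta_min \<beta>)\<^sup>2 \<le> lambda_min (Z\<^sup>T * H * Z) * sq_norm w"
    using mult_right_mono[OF _ sq_norm_nonneg[of w]] by fastforce
  thus ?thesis using lambda_min_le_sq_norm_v[OF Dne] by linarith
next
  case False
  hence "real n * delta ginv X \<beta> M * (beta_min \<beta>)\<^sup>2 \<le> 0"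
    by (simp add: mult_nonneg_nonpos mult_nonpos_nonneg)
  thus ?thesis using sq_norm_nonneg[of v] by linarith
qed

end

section \<open>Moment generating functions under the isotropic normal law\<close>

lemma nn_integral_normal_density:
  assumes "\<sigma> > 0"
  shows "(\<integral>\<^sup>+x. ennreal (normal_density \<mu> \<sigma> x) \<partial>lborel) = 1"
proof -
  interpret prob_space "density lborel (normal_density \<mu> \<sigma>)"
    using assms by (rule prob_space_normal_density)
  show ?thesis using emeasure_space_1 by (simp add: emeasure_density)
qed

lemma nn_integral_normal_exp_linear:
  assumes "\<sigma> > 0"
  shows "(\<integral>\<^sup>+x. ennreal (normal_density 0 \<sigma> x * exp (a * x)) \<partial>lborel) = ennreal (exp (a\<^sup>2 * \<sigma>\<^sup>2 / 2))"
proof -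
  have "normal_density 0 \<sigma> x * exp (a * x) = exp (a\<^sup>2 * \<sigma>\<^sup>2 / 2) * normal_density (a * \<sigma>\<^sup>2) \<sigma> x" for x
  proof -
    have "- x\<^sup>2 / (2 * \<sigma>\<^sup>2) + a * x = a\<^sup>2 * \<sigma>\<^sup>2 / 2 + - (x - a * \<sigma>\<^sup>2)\<^sup>2 / (2 * \<sigma>\<^sup>2)"
      using assms by (simp add: field_simps power2_eq_square)
    thus ?thesis by (simp add: normal_density_def exp_add[symmetric])
  qed
  hence "(\<integral>\<^sup>+x. ennreal (normal_density 0 \<sigma> x * exp (a * x)) \<partial>lborel)
      = (\<integral>\<^sup>+x. ennreal (exp (a\<^sup>2 * \<sigma>\<^sup>2 / 2)) * ennreal (normal_density (a * \<sigma>\<^sup>2) \<sigma> x) \<partial>lborel)"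
    by (simp add: ennreal_mult)
  also have "\<dots> = ennreal (exp (a\<^sup>2 * \<sigma>\<^sup>2 / 2))"
    using assms by (simp add: nn_integral_cmult nn_integral_normal_density)
  finally show ?thesis .
qed

text \<open>
  The integrand is a multiple of the density of variance \<open>\<sigma>\<^sup>2 / (1 + 2 t \<sigma>\<^sup>2)\<close>. Negative \<open>t\<close> are
  allowed, and give the exponential moments of a squared normal variable.
\<close>
lemma nn_integral_normal_exp_square:
  assumes "\<sigma> > 0" and t: "1 + 2 * t * \<sigma>\<^sup>2 > 0"
  shows "(\<integral>\<^sup>+x. ennreal (normal_density 0 \<sigma> x * exp (- t * x\<^sup>2)) \<partial>lborel)
    = ennreal (1 / sqrt (1 + 2 * t * \<sigma>\<^sup>2))"
proof -
  define q where "q = sqrt (1 + 2 * t * \<sigma>\<^sup>2)"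
  have q: "q > 0" "q\<^sup>2 = 1 + 2 * t * \<sigma>\<^sup>2" using t by (auto simp: q_def)
  have "normal_density 0 \<sigma> x * exp (- t * x\<^sup>2) = 1 / q * normal_density 0 (\<sigma> / q) x" for x
  proof -
    have "- x\<^sup>2 / (2 * \<sigma>\<^sup>2) + - t * x\<^sup>2 = - (x\<^sup>2 * q\<^sup>2) / (2 * \<sigma>\<^sup>2)"
      using assms(1) unfolding q(2) by (simp add: field_simps)
    moreover have "sqrt (2 * pi * (\<sigma> / q)\<^sup>2) = sqrt (2 * pi * \<sigma>\<^sup>2) / q"
      using q(1) by (simp add: real_sqrt_mult real_sqrt_divide power_divide)
    ultimately show ?thesis
      using q(1) by (simp add: normal_density_def exp_add[symmetric] power_divide)
  qed
  hence "(\<integral>\<^sup>+x. ennreal (normal_density 0 \<sigma> x * exp (- t * x\<^sup>2)) \<partial>lborel)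
      = (\<integral>\<^sup>+x. ennreal (1 / q) * ennreal (normal_density 0 (\<sigma> / q) x) \<partial>lborel)"
    using q(1) by (subst ennreal_mult[symmetric]) auto
  also have "\<dots> = ennreal (1 / q)"
    using assms(1) q(1) by (subst nn_integral_cmult) (auto simp: nn_integral_normal_density)
  finally show ?thesis unfolding q_def .
qed

lemma isotropic_normal_measurable:
  assumes "isotropic_normal P n \<sigma> \<epsilon>" "i < n"
  shows "\<epsilon> i \<in> borel_measurable P"
proof -
  have "(\<lambda>\<omega>. \<lambda>i\<in>{..<n}. \<epsilon> i \<omega>) \<in> measurable P (\<Pi>\<^sub>M i\<in>{..<n}. lborel)"
    using assms(1) unfolding isotropic_normal_def by (rule distributed_measurable)
  from measurable_compose[OF this measurable_component_singleton[of i "{..<n}"]] assms(2)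
  show ?thesis by simp
qed

text \<open>
  The joint density is a product of one-dimensional normal densities, so the expectation of a
  product of functions of the coordinates factorizes.
\<close>
lemma isotropic_normal_product:
  assumes iso: "isotropic_normal P n \<sigma> \<epsilon>" and "\<sigma> > 0"
    and g: "\<And>i. g i \<in> borel_measurable borel" "\<And>i x. g i x \<ge> 0"
  shows "(\<integral>\<^sup>+\<omega>. ennreal (\<Prod>i<n. g i (\<epsilon> i \<omega>)) \<partial>P)
    = (\<Prod>i<n. \<integral>\<^sup>+x. ennreal (normal_density 0 \<sigma> x * g i x) \<partial>lborel)"
proof -
  interpret product_sigma_finite "\<lambda>_::nat. lborel :: real measure" by standard
  define f where "f x = ennreal (exp (- (\<Sum>i<n. (x i)\<^sup>2) / (2 * \<sigma>\<^sup>2)) / sqrt (2 * pi * \<sigma>\<^sup>2) ^ n)" for x :: "nat \<Rightarrow> real"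
  define G where "G x = ennreal (\<Prod>i<n. g i (x i))" for x :: "nat \<Rightarrow> real"
  have Gm: "G \<in> borel_measurable (\<Pi>\<^sub>M i\<in>{..<n}. lborel)"
    unfolding G_def using g(1) by measurable
  have fG: "f x * G x = (\<Prod>i<n. ennreal (normal_density 0 \<sigma> (x i) * g i (x i)))" for x
  proof -
    have "exp (- (\<Sum>i<n. (x i)\<^sup>2) / (2 * \<sigma>\<^sup>2)) / sqrt (2 * pi * \<sigma>\<^sup>2) ^ n
      = (\<Prod>i<n. normal_density 0 \<sigma> (x i))"
      by (simp add: normal_density_def prod.distrib exp_sum[symmetric] prod_dividef power_one_over
          sum_negf sum_divide_distrib prod_constant)
    thus ?thesis unfolding f_def G_def
      by (simp add: prod_ennreal g ennreal_mult[symmetric] prod_nonneg prod.distrib)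
  qed
  have "(\<integral>\<^sup>+\<omega>. ennreal (\<Prod>i<n. g i (\<epsilon> i \<omega>)) \<partial>P) = (\<integral>\<^sup>+\<omega>. G (\<lambda>i\<in>{..<n}. \<epsilon> i \<omega>) \<partial>P)"
    by (simp add: G_def)
  also have "\<dots> = (\<integral>\<^sup>+x. f x * G x \<partial>(\<Pi>\<^sub>M i\<in>{..<n}. lborel))"
    by (rule distributed_nn_integral[symmetric, OF iso[unfolded isotropic_normal_def, folded f_def] Gm])
  also have "\<dots> = (\<integral>\<^sup>+x. (\<Prod>i<n. ennreal (normal_density 0 \<sigma> (x i) * g i (x i))) \<partial>(\<Pi>\<^sub>M i\<in>{..<n}. lborel))"
    by (simp only: fG)
  also have "\<dots> = (\<Prod>i<n. \<integral>\<^sup>+x. ennreal (normal_density 0 \<sigma> x * g i x) \<partial>lborel)"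
    using g(1) by (intro product_nn_integral_prod) auto
  finally show ?thesis .
qed

lemma isotropic_normal_mgf_linear:
  assumes iso: "isotropic_normal P n \<sigma> \<epsilon>" and s: "\<sigma> > 0"
  shows "(\<integral>\<^sup>+\<omega>. ennreal (exp (\<Sum>i<n. a i * \<epsilon> i \<omega>)) \<partial>P) = ennreal (exp (\<sigma>\<^sup>2 / 2 * (\<Sum>i<n. (a i)\<^sup>2)))"
proof -
  have "(\<integral>\<^sup>+\<omega>. ennreal (exp (\<Sum>i<n. a i * \<epsilon> i \<omega>)) \<partial>P) = (\<integral>\<^sup>+\<omega>. ennreal (\<Prod>i<n. exp (a i * \<epsilon> i \<omega>)) \<partial>P)"
    by (simp add: exp_sum)
  also have "\<dots> = (\<Prod>i<n. ennreal (exp ((a i)\<^sup>2 * \<sigma>\<^sup>2 / 2)))"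
    using isotropic_normal_product[OF iso s, of "\<lambda>i x. exp (a i * x)"]
    by (simp add: nn_integral_normal_exp_linear[OF s])
  also have "\<dots> = ennreal (exp (\<sigma>\<^sup>2 / 2 * (\<Sum>i<n. (a i)\<^sup>2)))"
    by (simp add: prod_ennreal exp_sum[symmetric] sum_distrib_left mult.commute)
  finally show ?thesis .
qed

lemma isotropic_normal_mgf_sq_norm:
  assumes iso: "isotropic_normal P n \<sigma> \<epsilon>" and s: "\<sigma> > 0" and t: "t \<ge> 0"
  shows "(\<integral>\<^sup>+\<omega>. ennreal (exp (- t * (\<Sum>i<n. (\<epsilon> i \<omega>)\<^sup>2))) \<partial>P) = ennreal ((1 / sqrt (1 + 2 * t * \<sigma>\<^sup>2)) ^ n)"
proof -
  have pos: "1 + 2 * t * \<sigma>\<^sup>2 > 0" using t by (simp add: add_pos_nonneg)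
  have "(\<integral>\<^sup>+\<omega>. ennreal (exp (- t * (\<Sum>i<n. (\<epsilon> i \<omega>)\<^sup>2))) \<partial>P)
      = (\<integral>\<^sup>+\<omega>. ennreal (\<Prod>i<n. exp (- t * (\<epsilon> i \<omega>)\<^sup>2)) \<partial>P)"
    by (simp add: exp_sum[symmetric] sum_distrib_left sum_negf)
  also have "\<dots> = (\<Prod>i<n. ennreal (1 / sqrt (1 + 2 * t * \<sigma>\<^sup>2)))"
    by (subst isotropic_normal_product[OF iso s, of "\<lambda>i x. exp (- t * x\<^sup>2)"])
      (simp_all only: nn_integral_normal_exp_square[OF s pos], auto)
  also have "\<dots> = ennreal ((1 / sqrt (1 + 2 * t * \<sigma>\<^sup>2)) ^ n)"
    using pos by (simp add: prod_constant ennreal_power)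
  finally show ?thesis .
qed

text \<open>
  Rotation invariance of the law is replaced by linearization: for a standard normal \<open>z\<close>, independent
  of the errors, \<open>exp (t q\<^sup>2)\<close> is the expectation of \<open>exp (sqrt (2 t) q z)\<close>. With one such variable for
  each of the \<open>r\<close> squares the exponent is linear in the errors. Integrating first over the errors gives
  \<open>exp (t \<sigma>\<^sup>2 |z|\<^sup>2)\<close>, because the \<open>u\<close> are orthonormal, and the remaining integral over \<open>z\<close> factorizes.
\<close>
lemma isotropic_normal_mgf_projection:
  assumes "prob_space P" and iso: "isotropic_normal P n \<sigma> \<epsilon>" and s: "\<sigma> > 0"
    and t: "t \<ge> 0" "2 * t * \<sigma>\<^sup>2 < 1"
    and orth: "\<And>k l. k < r \<Longrightarrow> l < r \<Longrightarrow> (\<Sum>i<n. u k i * u l i) = (if k = l then 1 else 0)"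
  shows "(\<integral>\<^sup>+\<omega>. ennreal (exp (t * (\<Sum>k<r. (\<Sum>i<n. u k i * \<epsilon> i \<omega>)\<^sup>2))) \<partial>P)
    = ennreal ((1 / sqrt (1 - 2 * t * \<sigma>\<^sup>2)) ^ r)"
proof -
  interpret P: prob_space P by fact
  define \<gamma> where "\<gamma> = density lborel (\<lambda>x. ennreal (std_normal_density x))"
  interpret g: prob_space \<gamma> unfolding \<gamma>_def by (rule prob_space_normal_density) simp
  interpret gs: product_prob_space "\<lambda>_::nat. \<gamma>" ..
  define Z where "Z = (\<Pi>\<^sub>M k\<in>{..<r}. \<gamma>)"
  interpret Z: prob_space Z unfolding Z_def by (rule prob_space_PiM) (rule g.prob_space_axioms)
  interpret PZ: pair_sigma_finite P Z ..
  have sets_\<gamma>[measurable_cong]: "sets \<gamma> = sets borel" by (simp add: \<gamma>_def)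
  have int_\<gamma>: "(\<integral>\<^sup>+x. ennreal (f x) \<partial>\<gamma>) = (\<integral>\<^sup>+x. ennreal (std_normal_density x * f x) \<partial>lborel)"
    if "f \<in> borel_measurable borel" for f
    unfolding \<gamma>_def using that by (subst nn_integral_density) (auto simp: ennreal_mult')
  define c where "c = sqrt (2 * t)"
  have c2: "c * c = 2 * t" using t by (simp add: c_def)
  define q where "q k \<omega> = (\<Sum>i<n. u k i * \<epsilon> i \<omega>)" for k \<omega>
  have qm[measurable]: "q k \<in> borel_measurable P" for k
    unfolding q_def by (intro borel_measurable_sum borel_measurable_times borel_measurable_const
        isotropic_normal_measurable[OF iso]) auto
  define F where "F \<omega> z = (\<Prod>k<r. exp (c * q k \<omega> * z k))" for \<omega> z
  have zm: "(\<lambda>x. snd x k) \<in> borel_measurable (P \<Otimes>\<^sub>M Z)" if "k < r" for k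
  proof -
    have "(\<lambda>z. z k) \<in> measurable Z \<gamma>"
      unfolding Z_def by (rule measurable_component_singleton) (use that in simp)
    hence "(\<lambda>z. z k) \<in> borel_measurable Z"
      using measurable_cong_sets[OF refl sets_\<gamma>] by blast
    thus ?thesis by (rule measurable_compose[OF measurable_snd])
  qed
  have Fm: "(\<lambda>(\<omega>, z). ennreal (F \<omega> z)) \<in> borel_measurable (P \<Otimes>\<^sub>M Z)"
  proof -
    have "(\<lambda>x. exp (c * q k (fst x) * snd x k)) \<in> borel_measurable (P \<Otimes>\<^sub>M Z)" if "k \<in> {..<r}" for k
    proof -
      have "k < r" using that by simp
      note zm[OF this, measurable]
      show ?thesis by measurable
    qed
    hence "(\<lambda>x. \<Prod>k<r. exp (c * q k (fst x) * snd x k)) \<in> borel_measurable (P \<Otimes>\<^sub>M Z)"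
      by (rule borel_measurable_prod)
    thus ?thesis unfolding F_def case_prod_beta by (rule measurable_compose[OF _ measurable_ennreal])
  qed
  \<comment> \<open>Linearization of each square by an auxiliary standard normal variable.\<close>
  have 1: "ennreal (exp (t * (\<Sum>k<r. (q k \<omega>)\<^sup>2))) = (\<integral>\<^sup>+z. ennreal (F \<omega> z) \<partial>Z)" for \<omega>
  proof -
    have "(\<integral>\<^sup>+z. ennreal (F \<omega> z) \<partial>Z) = (\<integral>\<^sup>+z. (\<Prod>k<r. ennreal (exp (c * q k \<omega> * z k))) \<partial>Z)"
      by (simp add: F_def prod_ennreal)
    also have "\<dots> = (\<Prod>k<r. \<integral>\<^sup>+z. ennreal (exp (c * q k \<omega> * z)) \<partial>\<gamma>)"
      unfolding Z_def by (intro gs.product_nn_integral_prod) auto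
    also have "\<dots> = (\<Prod>k<r. ennreal (exp ((c * q k \<omega>)\<^sup>2 / 2)))"
      by (subst int_\<gamma>) (simp_all add: nn_integral_normal_exp_linear)
    also have "\<dots> = ennreal (exp (\<Sum>k<r. (c * q k \<omega>)\<^sup>2 / 2))"
      by (simp add: prod_ennreal exp_sum)
    also have "(\<Sum>k<r. (c * q k \<omega>)\<^sup>2 / 2) = t * (\<Sum>k<r. (q k \<omega>)\<^sup>2)"
      by (simp add: sum_distrib_left power_mult_distrib power2_eq_square[of c] c2)
    finally show ?thesis by simp
  qed
  \<comment> \<open>Integrating out the errors for fixed auxiliary variables.\<close>
  have 2: "(\<integral>\<^sup>+\<omega>. ennreal (F \<omega> z) \<partial>P) = (\<Prod>k<r. ennreal (exp (t * \<sigma>\<^sup>2 * (z k)\<^sup>2)))" for z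
  proof -
    define a where "a i = (\<Sum>k<r. c * z k * u k i)" for i
    have "F \<omega> z = exp (\<Sum>i<n. a i * \<epsilon> i \<omega>)" for \<omega>
    proof -
      have "(\<Sum>k<r. c * q k \<omega> * z k) = (\<Sum>k<r. \<Sum>i<n. c * z k * u k i * \<epsilon> i \<omega>)"
        by (simp add: q_def sum_distrib_left sum_distrib_right mult_ac)
      also have "\<dots> = (\<Sum>i<n. a i * \<epsilon> i \<omega>)"
        unfolding a_def sum_distrib_right by (rule sum.swap)
      finally show ?thesis by (simp add: F_def exp_sum[symmetric])
    qed
    hence "(\<integral>\<^sup>+\<omega>. ennreal (F \<omega> z) \<partial>P) = ennreal (exp (\<sigma>\<^sup>2 / 2 * (\<Sum>i<n. (a i)\<^sup>2)))"
      using isotropic_normal_mgf_linear[OF iso s, of a] by simp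
    also have "(\<Sum>i<n. (a i)\<^sup>2) = 2 * t * (\<Sum>k<r. (z k)\<^sup>2)"
    proof -
      have "(\<Sum>i<n. (a i)\<^sup>2) = (\<Sum>i<n. \<Sum>k<r. \<Sum>l<r. (c * c * z k * z l) * (u k i * u l i))"
        by (simp add: a_def power2_eq_square sum_product mult_ac)
      also have "\<dots> = (\<Sum>k<r. \<Sum>i<n. \<Sum>l<r. (c * c * z k * z l) * (u k i * u l i))" by (rule sum.swap)
      also have "\<dots> = (\<Sum>k<r. \<Sum>l<r. \<Sum>i<n. (c * c * z k * z l) * (u k i * u l i))"
        by (rule sum.cong[OF refl], rule sum.swap)
      also have "\<dots> = (\<Sum>k<r. \<Sum>l<r. (c * c * z k * z l) * (\<Sum>i<n. u k i * u l i))"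
        by (simp add: sum_distrib_left)
      also have "\<dots> = (\<Sum>k<r. \<Sum>l<r. if k = l then c * c * z k * z l else 0)"
        by (intro sum.cong refl) (simp add: orth)
      also have "\<dots> = (\<Sum>k<r. c * c * (z k)\<^sup>2)" by (simp add: power2_eq_square mult_ac)
      also have "\<dots> = 2 * t * (\<Sum>k<r. (z k)\<^sup>2)" by (simp add: c2 sum_distrib_left)
      finally show ?thesis .
    qed
    finally show ?thesis by (simp add: prod_ennreal exp_sum[symmetric] sum_distrib_left mult_ac)
  qed
  have "(\<integral>\<^sup>+\<omega>. ennreal (exp (t * (\<Sum>k<r. (q k \<omega>)\<^sup>2))) \<partial>P) = (\<integral>\<^sup>+\<omega>. \<integral>\<^sup>+z. ennreal (F \<omega> z) \<partial>Z \<partial>P)"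
    by (simp only: 1)
  also have "\<dots> = (\<integral>\<^sup>+z. \<integral>\<^sup>+\<omega>. ennreal (F \<omega> z) \<partial>P \<partial>Z)"
    using PZ.Fubini'[OF Fm] by simp
  also have "\<dots> = (\<integral>\<^sup>+z. (\<Prod>k<r. ennreal (exp (t * \<sigma>\<^sup>2 * (z k)\<^sup>2))) \<partial>Z)" by (simp only: 2)
  also have "\<dots> = (\<Prod>k<r. \<integral>\<^sup>+z. ennreal (exp (t * \<sigma>\<^sup>2 * z\<^sup>2)) \<partial>\<gamma>)"
    unfolding Z_def by (intro gs.product_nn_integral_prod) auto
  also have "\<dots> = (\<Prod>k<r. ennreal (1 / sqrt (1 - 2 * t * \<sigma>\<^sup>2)))"
  proof -
    have "(\<integral>\<^sup>+z. ennreal (exp (t * \<sigma>\<^sup>2 * z\<^sup>2)) \<partial>\<gamma>)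
        = (\<integral>\<^sup>+z. ennreal (std_normal_density z * exp (- (- (t * \<sigma>\<^sup>2)) * z\<^sup>2)) \<partial>lborel)"
      by (subst int_\<gamma>) simp_all
    also have "\<dots> = ennreal (1 / sqrt (1 + 2 * (- (t * \<sigma>\<^sup>2)) * 1\<^sup>2))"
      by (rule nn_integral_normal_exp_square) (use t in auto)
    also have "1 + 2 * (- (t * \<sigma>\<^sup>2)) * 1\<^sup>2 = 1 - 2 * t * \<sigma>\<^sup>2" by simp
    finally show ?thesis by simp
  qed
  also have "\<dots> = ennreal ((1 / sqrt (1 - 2 * t * \<sigma>\<^sup>2)) ^ r)"
    using t by (simp add: prod_constant ennreal_power)
  finally show ?thesis unfolding q_def .
qed

section \<open>Exponential tail bounds\<close>

text \<open>
  Markov's inequality for \<open>exp Q\<close>.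
\<close>
lemma (in prob_space) prob_ge_le_exp_moment:
  assumes Q[measurable]: "Q \<in> borel_measurable M" and mgf: "(\<integral>\<^sup>+\<omega>. ennreal (exp (Q \<omega>)) \<partial>M) = ennreal b" and "b \<ge> 0"
  shows "prob {\<omega> \<in> space M. c \<le> Q \<omega>} \<le> b * exp (- c)"
proof -
  have "emeasure M {\<omega> \<in> space M. c \<le> Q \<omega>} = (\<integral>\<^sup>+\<omega>. indicator {\<omega> \<in> space M. c \<le> Q \<omega>} \<omega> \<partial>M)"
    by (rule nn_integral_indicator[symmetric]) measurable
  also have "\<dots> \<le> (\<integral>\<^sup>+\<omega>. ennreal (exp (- c)) * ennreal (exp (Q \<omega>)) \<partial>M)"
  proof (rule nn_integral_mono)
    fix \<omega>
    have "1 \<le> ennreal (exp (- c) * exp (Q \<omega>))" if "c \<le> Q \<omega>"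
      using that by (simp add: exp_add[symmetric])
    thus "indicator {\<omega> \<in> space M. c \<le> Q \<omega>} \<omega> \<le> ennreal (exp (- c)) * ennreal (exp (Q \<omega>))"
      by (auto simp: indicator_def ennreal_mult[symmetric])
  qed
  also have "\<dots> = ennreal (exp (- c)) * (\<integral>\<^sup>+\<omega>. ennreal (exp (Q \<omega>)) \<partial>M)"
    by (rule nn_integral_cmult) measurable
  also have "\<dots> = ennreal (b * exp (- c))"
    using \<open>b \<ge> 0\<close> unfolding mgf by (simp add: ennreal_mult[symmetric] mult.commute)
  finally have "ennreal (prob {\<omega> \<in> space M. c \<le> Q \<omega>}) \<le> ennreal (b * exp (- c))"
    by (simp only: emeasure_eq_measure)
  thus ?thesis using \<open>b \<ge> 0\<close> by (subst (asm) ennreal_le_iff) auto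
qed

lemma inverse_sqrt_power_le_exp:
  assumes "exp (- 2 * a) \<le> x"
  shows "(1 / sqrt x) ^ n \<le> exp (real n * a)"
proof -
  have x: "x > 0" using assms exp_gt_zero less_le_trans by blast
  have "sqrt (exp (- 2 * a)) = exp (- a)"
    by (rule real_sqrt_unique) (auto simp: exp_double[symmetric])
  hence "exp (- a) \<le> sqrt x" using real_sqrt_le_mono[OF assms] by simp
  hence "1 / sqrt x \<le> 1 / exp (- a)" using x by (intro divide_left_mono) auto
  hence "1 / sqrt x \<le> exp a" by (simp add: exp_minus field_simps)
  hence "(1 / sqrt x) ^ n \<le> exp a ^ n" using x by (intro power_mono) auto
  thus ?thesis by (simp add: exp_of_nat_mult)
qed

text \<open>
  The Chernoff bound at \<open>t = \<theta> / (2 \<sigma>\<^sup>2)\<close>. The mean \<open>\<sigma>\<^sup>2 r\<close> cancels the part of the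
  logarithmic moment generating function that is linear in \<open>\<theta>\<close>; the quadratic lower bound on
  \<open>ln (1 - \<theta>)\<close> bounds the rest by \<open>r \<theta>\<^sup>2\<close>.
\<close>
lemma projection_upper_tail:
  assumes "prob_space P" and iso: "isotropic_normal P n \<sigma> \<epsilon>" and s: "\<sigma> > 0"
    and \<theta>: "0 < \<theta>" "\<theta> \<le> 1 / 2"
    and orth: "\<And>k l. k < r \<Longrightarrow> l < r \<Longrightarrow> (\<Sum>i<n. u k i * u l i) = (if k = l then 1 else 0)"
  shows "measure P {\<omega> \<in> space P. \<sigma>\<^sup>2 * real r + \<eta> \<le> (\<Sum>k<r. (\<Sum>i<n. u k i * \<epsilon> i \<omega>)\<^sup>2)}
    \<le> exp (real r * \<theta>\<^sup>2 - \<theta> * \<eta> / (2 * \<sigma>\<^sup>2))"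
proof -
  interpret prob_space P by fact
  define t where "t = \<theta> / (2 * \<sigma>\<^sup>2)"
  have t: "t > 0" "2 * t * \<sigma>\<^sup>2 = \<theta>" using \<theta> s by (auto simp: t_def)
  define Q where "Q \<omega> = (\<Sum>k<r. (\<Sum>i<n. u k i * \<epsilon> i \<omega>)\<^sup>2)" for \<omega>
  have Qm: "Q \<in> borel_measurable P"
    unfolding Q_def by (intro borel_measurable_sum borel_measurable_power borel_measurable_times
        borel_measurable_const isotropic_normal_measurable[OF iso]) auto
  have "exp (- 2 * ((\<theta> + 2 * \<theta>\<^sup>2) / 2)) \<le> 1 - \<theta>"
  proof -
    have "- \<theta> - 2 * \<theta>\<^sup>2 \<le> ln (1 - \<theta>)" using \<theta> by (intro ln_one_minus_pos_lower_bound) auto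
    hence "exp (- \<theta> - 2 * \<theta>\<^sup>2) \<le> 1 - \<theta>" using \<theta> by (subst (asm) ln_ge_iff) auto
    moreover have "- 2 * ((\<theta> + 2 * \<theta>\<^sup>2) / 2) = - \<theta> - 2 * \<theta>\<^sup>2" by simp
    ultimately show ?thesis by metis
  qed
  hence mgf_le: "(1 / sqrt (1 - \<theta>)) ^ r \<le> exp (real r * ((\<theta> + 2 * \<theta>\<^sup>2) / 2))"
    by (rule inverse_sqrt_power_le_exp)
  have "measure P {\<omega> \<in> space P. \<sigma>\<^sup>2 * real r + \<eta> \<le> Q \<omega>}
      \<le> prob {\<omega> \<in> space P. t * (\<sigma>\<^sup>2 * real r + \<eta>) \<le> t * Q \<omega>}"
    using t Qm by (simp add: mult_le_cancel_left_pos)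
  also have "\<dots> \<le> (1 / sqrt (1 - \<theta>)) ^ r * exp (- (t * (\<sigma>\<^sup>2 * real r + \<eta>)))"
  proof (rule prob_ge_le_exp_moment)
    show "(\<lambda>\<omega>. t * Q \<omega>) \<in> borel_measurable P" using Qm by simp
    show "(\<integral>\<^sup>+\<omega>. ennreal (exp (t * Q \<omega>)) \<partial>P) = ennreal ((1 / sqrt (1 - \<theta>)) ^ r)"
      unfolding Q_def using isotropic_normal_mgf_projection[OF assms(1) iso s _ _ orth, where t = t] t \<theta> by simp
    show "0 \<le> (1 / sqrt (1 - \<theta>)) ^ r" using \<theta> by simp
  qed
  also have "\<dots> \<le> exp (real r * ((\<theta> + 2 * \<theta>\<^sup>2) / 2)) * exp (- (t * (\<sigma>\<^sup>2 * real r + \<eta>)))"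
    using mgf_le by (intro mult_right_mono) auto
  also have "\<dots> = exp (real r * \<theta>\<^sup>2 - \<theta> * \<eta> / (2 * \<sigma>\<^sup>2))"
  proof -
    have "real r * ((\<theta> + 2 * \<theta>\<^sup>2) / 2) + - (t * (\<sigma>\<^sup>2 * real r + \<eta>)) = real r * \<theta>\<^sup>2 - \<theta> * \<eta> / (2 * \<sigma>\<^sup>2)"
      using s by (simp add: t_def field_simps)
    thus ?thesis by (simp only: exp_add[symmetric])
  qed
  finally show ?thesis unfolding Q_def .
qed

lemma sq_norm_lower_tail:
  assumes "prob_space P" and iso: "isotropic_normal P n \<sigma> \<epsilon>" and s: "\<sigma> > 0"
    and \<theta>: "0 < \<theta>" "\<theta> \<le> 1 / 2"
  shows "measure P {\<omega> \<in> space P. (\<Sum>i<n. (\<epsilon> i \<omega>)\<^sup>2) \<le> \<sigma>\<^sup>2 * real n - \<eta>}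
    \<le> exp (real n * \<theta>\<^sup>2 - \<theta> * \<eta> / (2 * \<sigma>\<^sup>2))"
proof -
  interpret prob_space P by fact
  define t where "t = \<theta> / (2 * \<sigma>\<^sup>2)"
  have t: "t > 0" "2 * t * \<sigma>\<^sup>2 = \<theta>" using \<theta> s by (auto simp: t_def)
  define Q where "Q \<omega> = (\<Sum>i<n. (\<epsilon> i \<omega>)\<^sup>2)" for \<omega>
  have Qm: "Q \<in> borel_measurable P"
    unfolding Q_def by (intro borel_measurable_sum borel_measurable_power isotropic_normal_measurable[OF iso]) auto
  have "exp (- 2 * (- (\<theta> - 2 * \<theta>\<^sup>2) / 2)) \<le> 1 + \<theta>"
  proof -
    have "\<theta> - \<theta>\<^sup>2 \<le> ln (1 + \<theta>)" using \<theta> by (intro ln_one_plus_pos_lower_bound) auto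
    hence "\<theta> - 2 * \<theta>\<^sup>2 \<le> ln (1 + \<theta>)" using zero_le_power2[of \<theta>] by linarith
    hence "exp (\<theta> - 2 * \<theta>\<^sup>2) \<le> 1 + \<theta>" using \<theta> by (subst (asm) ln_ge_iff) auto
    moreover have "- 2 * (- (\<theta> - 2 * \<theta>\<^sup>2) / 2) = \<theta> - 2 * \<theta>\<^sup>2" by simp
    ultimately show ?thesis by metis
  qed
  hence mgf_le: "(1 / sqrt (1 + \<theta>)) ^ n \<le> exp (real n * (- (\<theta> - 2 * \<theta>\<^sup>2) / 2))"
    by (rule inverse_sqrt_power_le_exp)
  have "measure P {\<omega> \<in> space P. Q \<omega> \<le> \<sigma>\<^sup>2 * real n - \<eta>}
      \<le> prob {\<omega> \<in> space P. - t * (\<sigma>\<^sup>2 * real n - \<eta>) \<le> - t * Q \<omega>}"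
    using t Qm by (simp add: mult_le_cancel_left_pos)
  also have "\<dots> \<le> (1 / sqrt (1 + \<theta>)) ^ n * exp (- (- t * (\<sigma>\<^sup>2 * real n - \<eta>)))"
  proof (rule prob_ge_le_exp_moment)
    show "(\<lambda>\<omega>. - t * Q \<omega>) \<in> borel_measurable P" using Qm by simp
    show "(\<integral>\<^sup>+\<omega>. ennreal (exp (- t * Q \<omega>)) \<partial>P) = ennreal ((1 / sqrt (1 + \<theta>)) ^ n)"
      unfolding Q_def using isotropic_normal_mgf_sq_norm[OF iso s, of t] t by simp
    show "0 \<le> (1 / sqrt (1 + \<theta>)) ^ n" using \<theta> by simp
  qed
  also have "\<dots> \<le> exp (real n * (- (\<theta> - 2 * \<theta>\<^sup>2) / 2)) * exp (- (- t * (\<sigma>\<^sup>2 * real n - \<eta>)))"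
    using mgf_le by (intro mult_right_mono) auto
  also have "\<dots> = exp (real n * \<theta>\<^sup>2 - \<theta> * \<eta> / (2 * \<sigma>\<^sup>2))"
  proof -
    have "real n * (- (\<theta> - 2 * \<theta>\<^sup>2) / 2) + - (- t * (\<sigma>\<^sup>2 * real n - \<eta>)) = real n * \<theta>\<^sup>2 - \<theta> * \<eta> / (2 * \<sigma>\<^sup>2)"
      using s by (simp add: t_def field_simps)
    thus ?thesis by (simp only: exp_add[symmetric])
  qed
  finally show ?thesis unfolding Q_def .
qed

text \<open>
  The Chernoff bound at the minimizer \<open>t = 1 / (8 \<sigma>\<^sup>2)\<close> of \<open>2 \<sigma>\<^sup>2 t\<^sup>2 |v|\<^sup>2 - t |v|\<^sup>2 / 2\<close>.
\<close>
lemma cross_term_tail: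
  assumes "prob_space P" and iso: "isotropic_normal P n \<sigma> \<epsilon>" and s: "\<sigma> > 0"
  shows "measure P {\<omega> \<in> space P. (\<Sum>i<n. (v i)\<^sup>2) / 2 \<le> - 2 * (\<Sum>i<n. v i * \<epsilon> i \<omega>)}
    \<le> exp (- (\<Sum>i<n. (v i)\<^sup>2) / (32 * \<sigma>\<^sup>2))"
proof -
  interpret prob_space P by fact
  define V where "V = (\<Sum>i<n. (v i)\<^sup>2)"
  define t where "t = 1 / (8 * \<sigma>\<^sup>2)"
  have t: "t > 0" using s by (simp add: t_def)
  define Q where "Q \<omega> = - 2 * (\<Sum>i<n. v i * \<epsilon> i \<omega>)" for \<omega>
  have Qm: "Q \<in> borel_measurable P"
    unfolding Q_def by (intro borel_measurable_sum borel_measurable_times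
        borel_measurable_const isotropic_normal_measurable[OF iso]) auto
  have tQ: "t * Q \<omega> = (\<Sum>i<n. (- 2 * t * v i) * \<epsilon> i \<omega>)" for \<omega>
    by (simp add: Q_def sum_distrib_left mult_ac sum_negf)
  have sq: "(\<Sum>i<n. (- 2 * t * v i)\<^sup>2) = 4 * t\<^sup>2 * V"
    by (simp add: V_def sum_distrib_left power_mult_distrib)
  have "measure P {\<omega> \<in> space P. V / 2 \<le> Q \<omega>} \<le> prob {\<omega> \<in> space P. t * (V / 2) \<le> t * Q \<omega>}"
    using t Qm by (simp add: mult_le_cancel_left_pos)
  also have "\<dots> \<le> exp (\<sigma>\<^sup>2 / 2 * (4 * t\<^sup>2 * V)) * exp (- (t * (V / 2)))"
  proof (rule prob_ge_le_exp_moment)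
    show "(\<lambda>\<omega>. t * Q \<omega>) \<in> borel_measurable P" using Qm by simp
    show "(\<integral>\<^sup>+\<omega>. ennreal (exp (t * Q \<omega>)) \<partial>P) = ennreal (exp (\<sigma>\<^sup>2 / 2 * (4 * t\<^sup>2 * V)))"
      unfolding tQ sq[symmetric] by (rule isotropic_normal_mgf_linear[OF iso s])
  qed simp
  also have "\<dots> = exp (- V / (32 * \<sigma>\<^sup>2))"
  proof -
    have "\<sigma>\<^sup>2 / 2 * (4 * t\<^sup>2 * V) + - (t * (V / 2)) = - V / (32 * \<sigma>\<^sup>2)"
      using s by (simp add: t_def power2_eq_square field_simps)
    thus ?thesis by (simp only: exp_add[symmetric])
  qed
  finally show ?thesis unfolding Q_def V_def .
qed

section \<open>Almost sure bounds along a sequence of models\<close>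

text \<open>
  The Borel-Cantelli lemma for events that are measurable and bounded only from some index on.
\<close>
lemma AE_eventually_not_in_if_summable:
  assumes "prob_space P" and ev: "\<forall>\<^sub>F n in sequentially. E n \<in> sets P \<and> measure P (E n) \<le> b n"
    and "summable b"
  shows "AE \<omega> in P. \<forall>\<^sub>F n in sequentially. \<omega> \<notin> E n"
proof -
  interpret prob_space P by fact
  obtain m where m: "\<And>n. n \<ge> m \<Longrightarrow> E n \<in> sets P \<and> measure P (E n) \<le> b n"
    using ev unfolding eventually_sequentially by blast
  define A where "A n = (if n \<ge> m then E n else {})" for n
  have "AE \<omega> in P. \<forall>\<^sub>F n in sequentially. \<omega> \<in> space P - A n"
  proof (rule borel_cantelli_AE1)
    show "A n \<in> sets P" for n using m by (auto simp: A_def)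
    show "emeasure P (A n) < \<infinity>" for n by (simp add: less_top[symmetric])
    show "summable (\<lambda>n. measure P (A n))"
      by (rule summable_comparison_test'[OF \<open>summable b\<close>, of m]) (use m in \<open>auto simp: A_def\<close>)
  qed
  moreover have "\<forall>\<^sub>F n in sequentially. A n = E n"
    unfolding A_def eventually_sequentially by auto
  ultimately show ?thesis
    by (elim AE_mp) (auto intro!: AE_I2 elim: eventually_elim2)
qed

text \<open>
  A small enough \<open>\<theta>\<close> makes the quadratic term of the tail bounds at most half of the linear one,
  uniformly in all \<open>r \<le> s\<close>; \<open>v\<close> is the variance of the errors.
\<close>
lemma chernoff_exponent_choice:
  fixes \<eta> v :: real
  assumes "\<eta> > 0" "v > 0"
  obtains \<theta> e where "0 < \<theta>" "\<theta> \<le> 1 / 2" "e > 0"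
    "\<And>r s. 0 \<le> r \<Longrightarrow> r \<le> s \<Longrightarrow> exp (r * \<theta>\<^sup>2 - \<theta> * (\<eta> * s) / (2 * v)) \<le> exp (- e * s)"
proof -
  define \<theta> where "\<theta> = min (1 / 2) (\<eta> / (4 * v))"
  have \<theta>: "0 < \<theta>" "\<theta> \<le> 1 / 2" "\<theta> \<le> \<eta> / (4 * v)" using assms by (auto simp: \<theta>_def)
  show ?thesis
  proof (rule that[of \<theta> "\<theta> * \<eta> / (4 * v)"])
    fix r s :: real assume rs: "0 \<le> r" "r \<le> s"
    have "r * \<theta>\<^sup>2 \<le> s * (\<theta> * (\<eta> / (4 * v)))"
      unfolding power2_eq_square using rs \<theta> by (intro mult_mono) auto
    hence "r * \<theta>\<^sup>2 - \<theta> * (\<eta> * s) / (2 * v) \<le> - (\<theta> * \<eta> / (4 * v)) * s"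
      using assms by (simp add: field_simps)
    thus "exp (r * \<theta>\<^sup>2 - \<theta> * (\<eta> * s) / (2 * v)) \<le> exp (- (\<theta> * \<eta> / (4 * v)) * s)" by simp
  qed (use \<theta> assms in auto)
qed

text \<open>
  The scale \<open>s\<close> of the deviation is only required to dominate the ranks. It will be \<open>n \<delta> beta_min\<^sup>2\<close>
  under condition (a) and \<open>n\<close> under condition (b).
\<close>
lemma AE_eventually_projection_le:
  fixes s :: "nat \<Rightarrow> real"
  assumes "prob_space P" and iso: "\<forall>n\<ge>N. isotropic_normal P n \<sigma> (\<epsilon> n)" and \<sigma>: "\<sigma> > 0"
    and orth: "\<And>n k l. n \<ge> N \<Longrightarrow> k < r n \<Longrightarrow> l < r n \<Longrightarrow> (\<Sum>i<n. u n k i * u n l i) = (if k = l then 1 else 0)"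
    and rs: "\<forall>\<^sub>F n in sequentially. real (r n) \<le> s n"
    and summ: "\<forall>e>0. summable (\<lambda>n. exp (- e * s n))"
    and \<eta>: "\<eta> > 0"
  shows "AE \<omega> in P. \<forall>\<^sub>F n in sequentially.
    (\<Sum>k<r n. (\<Sum>i<n. u n k i * \<epsilon> n i \<omega>)\<^sup>2) \<le> \<sigma>\<^sup>2 * real (r n) + \<eta> * s n"
proof -
  obtain \<theta> e where \<theta>: "0 < \<theta>" "\<theta> \<le> 1 / 2" and e: "e > 0"
    and bnd: "\<And>r s. 0 \<le> r \<Longrightarrow> r \<le> s \<Longrightarrow> exp (r * \<theta>\<^sup>2 - \<theta> * (\<eta> * s) / (2 * \<sigma>\<^sup>2)) \<le> exp (- e * s)"
    by (rule chernoff_exponent_choice[of \<eta> "\<sigma>\<^sup>2"]) (use \<eta> \<sigma> in auto)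
  define Q where "Q n \<omega> = (\<Sum>k<r n. (\<Sum>i<n. u n k i * \<epsilon> n i \<omega>)\<^sup>2)" for n \<omega>
  define E where "E n = {\<omega> \<in> space P. \<sigma>\<^sup>2 * real (r n) + \<eta> * s n \<le> Q n \<omega>}" for n
  have "AE \<omega> in P. \<forall>\<^sub>F n in sequentially. \<omega> \<notin> E n"
  proof (rule AE_eventually_not_in_if_summable[OF assms(1) _ summ[rule_format, OF e]])
    show "\<forall>\<^sub>F n in sequentially. E n \<in> sets P \<and> measure P (E n) \<le> exp (- e * s n)"
      using rs eventually_ge_at_top[of N]
    proof eventually_elim
      case (elim n)
      have Qm: "Q n \<in> borel_measurable P"
        unfolding Q_def by (intro borel_measurable_sum borel_measurable_power borel_measurable_times
            borel_measurable_const isotropic_normal_measurable[OF iso[rule_format, OF elim(2)]]) auto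
      have "measure P (E n) \<le> exp (real (r n) * \<theta>\<^sup>2 - \<theta> * (\<eta> * s n) / (2 * \<sigma>\<^sup>2))"
        unfolding E_def Q_def
        by (rule projection_upper_tail[OF assms(1) iso[rule_format, OF elim(2)] \<sigma> \<theta> orth[OF elim(2)]])
      also have "\<dots> \<le> exp (- e * s n)" using elim(1) by (intro bnd) auto
      finally show ?case using Qm unfolding E_def by simp
    qed
  qed
  thus ?thesis using AE_space
  proof eventually_elim
    case (elim \<omega>)
    from elim(1) show ?case
      by eventually_elim (use elim(2) in \<open>auto simp: E_def Q_def\<close>)
  qed
qed

lemma summable_exp_neg_mult_nat: "\<forall>e>0. summable (\<lambda>n. exp (- e * real n))"
proof (intro allI impI)
  fix e :: real assume "e > 0"
  hence "summable (\<lambda>n. exp (- e) ^ n)" by (intro summable_geometric) simp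
  thus "summable (\<lambda>n. exp (- e * real n))" by (simp add: exp_of_nat_mult[symmetric] mult.commute)
qed

lemma AE_eventually_sq_norm_ge:
  assumes "prob_space P" and iso: "\<forall>n\<ge>N. isotropic_normal P n \<sigma> (\<epsilon> n)" and \<sigma>: "\<sigma> > 0"
    and \<eta>: "\<eta> > 0"
  shows "AE \<omega> in P. \<forall>\<^sub>F n in sequentially. \<sigma>\<^sup>2 * real n - \<eta> * real n \<le> (\<Sum>i<n. (\<epsilon> n i \<omega>)\<^sup>2)"
proof -
  obtain \<theta> e where \<theta>: "0 < \<theta>" "\<theta> \<le> 1 / 2" and e: "e > 0"
    and bnd: "\<And>r s. 0 \<le> r \<Longrightarrow> r \<le> s \<Longrightarrow> exp (r * \<theta>\<^sup>2 - \<theta> * (\<eta> * s) / (2 * \<sigma>\<^sup>2)) \<le> exp (- e * s)"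
    by (rule chernoff_exponent_choice[of \<eta> "\<sigma>\<^sup>2"]) (use \<eta> \<sigma> in auto)
  define Q where "Q n \<omega> = (\<Sum>i<n. (\<epsilon> n i \<omega>)\<^sup>2)" for n \<omega>
  define E where "E n = {\<omega> \<in> space P. Q n \<omega> \<le> \<sigma>\<^sup>2 * real n - \<eta> * real n}" for n
  have "AE \<omega> in P. \<forall>\<^sub>F n in sequentially. \<omega> \<notin> E n"
  proof (rule AE_eventually_not_in_if_summable[OF assms(1) _ summable_exp_neg_mult_nat[rule_format, OF e]])
    show "\<forall>\<^sub>F n in sequentially. E n \<in> sets P \<and> measure P (E n) \<le> exp (- e * real n)"
      using eventually_ge_at_top[of N]
    proof eventually_elim
      case (elim n)
      have Qm: "Q n \<in> borel_measurable P"
        unfolding Q_def by (intro borel_measurable_sum borel_measurable_power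
            isotropic_normal_measurable[OF iso[rule_format, OF elim]]) auto
      have "measure P (E n) \<le> exp (real n * \<theta>\<^sup>2 - \<theta> * (\<eta> * real n) / (2 * \<sigma>\<^sup>2))"
        unfolding E_def Q_def
        by (rule sq_norm_lower_tail[OF assms(1) iso[rule_format, OF elim] \<sigma> \<theta>])
      also have "\<dots> \<le> exp (- e * real n)" by (intro bnd) auto
      finally show ?case using Qm unfolding E_def by simp
    qed
  qed
  thus ?thesis using AE_space
  proof eventually_elim
    case (elim \<omega>)
    from elim(1) show ?case
      by eventually_elim (use elim(2) in \<open>auto simp: E_def Q_def\<close>)
  qed
qed

lemma AE_eventually_cross_term_le:
  fixes s :: "nat \<Rightarrow> real"
  assumes "prob_space P" and iso: "\<forall>n\<ge>N. isotropic_normal P n \<sigma> (\<epsilon> n)" and \<sigma>: "\<sigma> > 0"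
    and sv: "\<forall>\<^sub>F n in sequentially. s n \<le> (\<Sum>i<n. (v n i)\<^sup>2)"
    and summ: "\<forall>e>0. summable (\<lambda>n. exp (- e * s n))"
  shows "AE \<omega> in P. \<forall>\<^sub>F n in sequentially.
    - 2 * (\<Sum>i<n. v n i * \<epsilon> n i \<omega>) \<le> (\<Sum>i<n. (v n i)\<^sup>2) / 2"
proof -
  define Q where "Q n \<omega> = - 2 * (\<Sum>i<n. v n i * \<epsilon> n i \<omega>)" for n \<omega>
  define E where "E n = {\<omega> \<in> space P. (\<Sum>i<n. (v n i)\<^sup>2) / 2 \<le> Q n \<omega>}" for n
  define e where "e = 1 / (32 * \<sigma>\<^sup>2)"
  have e: "e > 0" using \<sigma> by (simp add: e_def)
  have "AE \<omega> in P. \<forall>\<^sub>F n in sequentially. \<omega> \<notin> E n"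
  proof (rule AE_eventually_not_in_if_summable[OF assms(1) _ summ[rule_format, OF e]])
    show "\<forall>\<^sub>F n in sequentially. E n \<in> sets P \<and> measure P (E n) \<le> exp (- e * s n)"
      using sv eventually_ge_at_top[of N]
    proof eventually_elim
      case (elim n)
      have Qm: "Q n \<in> borel_measurable P"
        unfolding Q_def by (intro borel_measurable_sum borel_measurable_times
            borel_measurable_const isotropic_normal_measurable[OF iso[rule_format, OF elim(2)]]) auto
      have "measure P (E n) \<le> exp (- (\<Sum>i<n. (v n i)\<^sup>2) / (32 * \<sigma>\<^sup>2))"
        unfolding E_def Q_def by (rule cross_term_tail[OF assms(1) iso[rule_format, OF elim(2)] \<sigma>])
      also have "\<dots> \<le> exp (- e * s n)"
        using elim(1) \<sigma> by (simp add: e_def divide_right_mono)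
      finally show ?case using Qm unfolding E_def by simp
    qed
  qed
  thus ?thesis using AE_space
  proof eventually_elim
    case (elim \<omega>)
    from elim(1) show ?case
      by eventually_elim (use elim(2) in \<open>auto simp: E_def Q_def\<close>)
  qed
qed

lemma AE_eventually_sq_norm_projection_le:
  fixes K :: "nat \<Rightarrow> real mat" and s :: "nat \<Rightarrow> real"
  assumes "prob_space P" and iso: "\<forall>n\<ge>N. isotropic_normal P n \<sigma> (\<epsilon> n)" and \<sigma>: "\<sigma> > 0"
    and squares: "\<forall>n\<ge>N. orthonormal_squares n (r n) (K n)"
    and rs: "\<forall>\<^sub>F n in sequentially. real (r n) \<le> s n"
    and summ: "\<forall>e>0. summable (\<lambda>n. exp (- e * s n))"
    and \<eta>: "\<eta> > 0"
  shows "AE \<omega> in P. \<forall>\<^sub>F n in sequentially.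
    sq_norm (K n *\<^sub>v vec n (\<lambda>i. \<epsilon> n i \<omega>)) \<le> \<sigma>\<^sup>2 * real (r n) + \<eta> * s n"
proof -
  obtain u where u: "\<And>n k. n \<ge> N \<Longrightarrow> u n k \<in> carrier_vec n"
    "\<And>n k l. n \<ge> N \<Longrightarrow> k < r n \<Longrightarrow> l < r n \<Longrightarrow> u n k \<bullet> u n l = (if k = l then 1 else 0)"
    "\<And>n e. n \<ge> N \<Longrightarrow> e \<in> carrier_vec n \<Longrightarrow> sq_norm (K n *\<^sub>v e) = (\<Sum>k<r n. (u n k \<bullet> e)\<^sup>2)"
    using squares unfolding orthonormal_squares_def by metis
  have "AE \<omega> in P. \<forall>\<^sub>F n in sequentially.
    (\<Sum>k<r n. (\<Sum>i<n. u n k $ i * \<epsilon> n i \<omega>)\<^sup>2) \<le> \<sigma>\<^sup>2 * real (r n) + \<eta> * s n"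
  proof (rule AE_eventually_projection_le[OF assms(1) iso \<sigma> _ rs summ \<eta>])
    fix n k l assume "n \<ge> N" "k < r n" "l < r n"
    thus "(\<Sum>i<n. u n k $ i * u n l $ i) = (if k = l then 1 else 0)"
      using u(2)[of n k l] carrier_vecD[OF u(1)[of n l]] by (simp add: scalar_prod_eq_sum)
  qed
  thus ?thesis
  proof eventually_elim
    case (elim \<omega>)
    thus ?case using eventually_ge_at_top[of N]
      by eventually_elim (simp add: u(3) scalar_prod_eq_sum)
  qed
qed

section \<open>Separation of good from bad submodels\<close>

lemma eventually_ge_if_summable_exp:
  fixes s :: "nat \<Rightarrow> real"
  assumes "summable (\<lambda>n. exp (- s n))"
  shows "\<forall>\<^sub>F n in sequentially. c \<le> s n"
proof -
  have "(\<lambda>n. exp (- s n)) \<longlonglongrightarrow> 0" by (rule summable_LIMSEQ_zero[OF assms])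
  hence "\<forall>\<^sub>F n in sequentially. exp (- s n) < exp (- c)" by (rule order_tendstoD) simp
  thus ?thesis by eventually_elim simp
qed

lemma limsup_neg_if_eventually_le_neg_one:
  assumes "\<forall>\<^sub>F n in sequentially. f n \<le> (-1::real)"
  shows "limsup (\<lambda>n. ereal (f n)) < 0"
proof -
  have "limsup (\<lambda>n. ereal (f n)) \<le> ereal (-1)"
    by (rule Limsup_bounded) (use assms in \<open>simp\<close>)
  also have "\<dots> < 0" by simp
  finally show ?thesis .
qed

theorem theorem7p3:
  fixes P :: "'w measure"
    and N :: nat
    and p M d :: "nat \<Rightarrow> nat"
    and X :: "nat \<Rightarrow> real mat"
    and \<beta> :: "nat \<Rightarrow> real vec"
    and \<epsilon> :: "nat \<Rightarrow> nat \<Rightarrow> 'w \<Rightarrow> real"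
    and \<sigma> :: real
    and ginv :: "real mat \<Rightarrow> real mat"
    and bmin \<delta> :: "nat \<Rightarrow> real"
    and FA FB :: "(nat \<Rightarrow> nat set) set"
  defines "d \<equiv> \<lambda>n. card (true_submodel (\<beta> n))"
    and "bmin \<equiv> \<lambda>n. beta_min (\<beta> n)"
    and "\<delta> \<equiv> \<lambda>n. delta ginv (X n) (\<beta> n) (M n)"
    and "FA \<equiv> (\<Pi> n\<in>{N..}. good_submodels (\<beta> n) (M n))"
    and "FB \<equiv> (\<Pi> n\<in>{N..}. bad_submodels (\<beta> n) (M n))"
  assumes "prob_space P"
    and "N \<ge> 1"
    and X: "\<And>n. n \<ge> N \<Longrightarrow> X n \<in> carrier_mat n (p n)"
    and beta: "\<And>n. n \<ge> N \<Longrightarrow> \<beta> n \<in> carrier_vec (p n)"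
    and M: "\<And>n. n \<ge> N \<Longrightarrow> d n \<le> M n \<and> M n < n"
    and ginv: "\<And>A. is_generalized_inverse A (ginv A)"
    and sigma: "\<sigma> > 0"
    and eps: "\<And>n. n \<ge> N \<Longrightarrow> isotropic_normal P n \<sigma> (\<epsilon> n)"
    and bounded: "\<exists>C>0. \<forall>n\<ge>N. \<forall>j\<in>true_submodel (\<beta> n). (\<Sum>i<n. (X n $$ (i, j))\<^sup>2) / real n \<le> C"
    and a_or_b:
      "((\<lambda>n. real (M n)) \<in> o(\<lambda>n. real n * \<delta> n * (bmin n)\<^sup>2)
        \<and> (\<forall>e>0. summable (\<lambda>n. exp (- e * real n * \<delta> n * (bmin n)\<^sup>2)))
        \<and> (\<forall>e>0. summable (\<lambda>n. exp (- e * real n * (\<delta> n)\<^sup>2 * bmin n ^ 4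
                                       / (real (d n) * sq_norm (\<beta> n))))))
       \<or>
       ((\<exists>\<alpha>. 0 < \<alpha> \<and> \<alpha> < 1 \<and> (\<lambda>n. real (M n) / real n) \<longlonglongrightarrow> \<alpha>)
        \<and> (\<exists>l. 0 \<le> l \<and> l < 1 \<and>
             (\<forall>A \<in> FA \<union> FB.
                (\<lambda>n. real (vec_space.rank n (H_mat ginv (X n) (A n))) / real n) \<longlonglongrightarrow> l))
        \<and> (\<exists>c>0. \<forall>n\<ge>N. \<delta> n * (bmin n)\<^sup>2 \<ge> c)
        \<and> (\<forall>e>0. summable (\<lambda>n. exp (- e * real n / (real (d n) * sq_norm (\<beta> n))))))"
  shows "weakly_separates P (\<lambda>n A \<omega>. rss ginv (X n) (response (X n) (\<beta> n) (\<lambda>i. \<epsilon> n i \<omega>)) A) FA FB"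
  unfolding weakly_separates_def
proof (intro ballI)
  have iso: "\<forall>n\<ge>N. isotropic_normal P n \<sigma> (\<epsilon> n)" using eps by blast
  fix A B assume AF: "A \<in> FA" and BF: "B \<in> FB"
  define rA where "rA n = vec_space.rank n (H_mat ginv (X n) (A n))" for n
  define rB where "rB n = vec_space.rank n (H_mat ginv (X n) (B n))" for n
  define rW where "rW n = vec_space.rank n (submat_cols (X n) (B n))" for n
  define HA where "HA n = H_mat ginv (X n) (A n)" for n
  define KB where "KB n = (let W = submat_cols (X n) (B n) in W * ginv (W\<^sup>T * W) * W\<^sup>T)" for n
  define v where "v n = submodel_regression.v ginv (X n) (\<beta> n) (B n)" for n
  define e where "e n \<omega> = vec n (\<lambda>i. \<epsilon> n i \<omega>)" for n \<omega>
  define s where "s n = real n * \<delta> n * (bmin n)\<^sup>2" for n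
  define diff where "diff n \<omega> = rss ginv (X n) (response (X n) (\<beta> n) (\<lambda>i. \<epsilon> n i \<omega>)) (A n)
    - rss ginv (X n) (response (X n) (\<beta> n) (\<lambda>i. \<epsilon> n i \<omega>)) (B n)" for n \<omega>
  have A: "A n \<in> good_submodels (\<beta> n) (M n)" and B: "B n \<in> bad_submodels (\<beta> n) (M n)" if "n \<ge> N" for n
    using AF BF that by (auto simp: FA_def FB_def)
  have RA: "submodel_regression ginv (X n) (\<beta> n) n (p n) (A n)"
    and RB: "submodel_regression ginv (X n) (\<beta> n) n (p n) (B n)" if n: "n \<ge> N" for n
    using A[OF n] B[OF n] X[OF n] beta[OF n] ginv
    by (auto simp: submodel_regression_def good_submodels_def bad_submodels_def submodels_def)
  have diff_eq: "diff n \<omega> = sq_norm (HA n *\<^sub>v e n \<omega>) + sq_norm (KB n *\<^sub>v e n \<omega>) - sq_norm (e n \<omega>)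
      - 2 * (v n \<bullet> e n \<omega>) - sq_norm (v n)" if n: "n \<ge> N" for n \<omega>
  proof -
    interpret RA: submodel_regression ginv "X n" "\<beta> n" n "p n" "A n" by (rule RA[OF n])
    interpret RB: submodel_regression ginv "X n" "\<beta> n" n "p n" "B n" by (rule RB[OF n])
    have en: "e n \<omega> \<in> carrier_vec n" by (simp add: e_def)
    have "RA.v = 0\<^sub>v n" using A[OF n] by (intro RA.v_eq_0) (simp add: good_submodels_def)
    hence "rss ginv (X n) (response (X n) (\<beta> n) (\<lambda>i. \<epsilon> n i \<omega>)) (A n) = sq_norm (HA n *\<^sub>v e n \<omega>)"
      using RA.rss_response[of "\<lambda>i. \<epsilon> n i \<omega>"] by (simp add: sq_norm_def HA_def e_def)
    thus ?thesis
      using RB.rss_response[of "\<lambda>i. \<epsilon> n i \<omega>"] RB.P.pythagoras[OF en]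
      by (simp add: diff_def v_def KB_def e_def Let_def)
  qed
  have HA_le: "sq_norm (HA n *\<^sub>v e n \<omega>) \<le> sq_norm (e n \<omega>)" if n: "n \<ge> N" for n \<omega>
  proof -
    interpret RA: submodel_regression ginv "X n" "\<beta> n" n "p n" "A n" by (rule RA[OF n])
    have "e n \<omega> \<in> carrier_vec n" by (simp add: e_def)
    from RA.P.pythagoras[OF this] sq_norm_nonneg show ?thesis unfolding HA_def
      by (metis le_add_same_cancel1)
  qed
  have sv: "s n \<le> sq_norm (v n)" if n: "n \<ge> N" for n
  proof -
    interpret RB: submodel_regression ginv "X n" "\<beta> n" n "p n" "B n" by (rule RB[OF n])
    show ?thesis unfolding s_def \<delta>_def bmin_def v_def
      by (rule RB.delta_beta_min_le_sq_norm_v[OF B[OF n]]) (use n \<open>N \<ge> 1\<close> in simp)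
  qed
  have v_sum: "(\<Sum>i<n. (v n $ i)\<^sup>2) = sq_norm (v n)"
    and v_e: "(\<Sum>i<n. v n $ i * \<epsilon> n i \<omega>) = v n \<bullet> e n \<omega>" if n: "n \<ge> N" for n \<omega>
  proof -
    interpret RB: submodel_regression ginv "X n" "\<beta> n" n "p n" "B n" by (rule RB[OF n])
    have "dim_vec (v n) = n" using RB.v by (simp add: v_def)
    thus "(\<Sum>i<n. (v n $ i)\<^sup>2) = sq_norm (v n)" "(\<Sum>i<n. v n $ i * \<epsilon> n i \<omega>) = v n \<bullet> e n \<omega>"
      by (auto simp: sq_norm_eq_sum scalar_prod_eq_sum e_def)
  qed
  have KB_squares: "\<forall>n\<ge>N. orthonormal_squares n (rW n) (KB n)"
  proof (intro allI impI)
    fix n assume "n \<ge> N"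
    then interpret RB: submodel_regression ginv "X n" "\<beta> n" n "p n" "B n" by (rule RB)
    show "orthonormal_squares n (rW n) (KB n)"
      using RB.P.K_squares by (simp add: rW_def KB_def Let_def)
  qed
  have HA_squares: "\<forall>n\<ge>N. orthonormal_squares n (rA n) (HA n)"
  proof (intro allI impI)
    fix n assume "n \<ge> N"
    then interpret RA: submodel_regression ginv "X n" "\<beta> n" n "p n" "A n" by (rule RA)
    show "orthonormal_squares n (rA n) (HA n)"
      using RA.P.H_squares by (simp add: rA_def HA_def)
  qed
  have rW_le: "rW n \<le> M n" if n: "n \<ge> N" for n
  proof -
    have "card (B n) = M n" using B[OF n] by (simp add: bad_submodels_def submodels_def)
    thus ?thesis using vec_space.rank_le_nc[OF submodel_regression.W[OF RB[OF n]]] by (simp add: rW_def)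
  qed
  have rank_sum: "rB n + rW n = n" and rA_le: "rA n \<le> n" if n: "n \<ge> N" for n
  proof -
    interpret RA: submodel_regression ginv "X n" "\<beta> n" n "p n" "A n" by (rule RA[OF n])
    interpret RB: submodel_regression ginv "X n" "\<beta> n" n "p n" "B n" by (rule RB[OF n])
    show "rB n + rW n = n" using RB.P.rank_complement by (simp add: rB_def rW_def)
    show "rA n \<le> n" using RA.P.rank_complement unfolding rA_def by linarith
  qed
  have cross: "AE \<omega> in P. \<forall>\<^sub>F n in sequentially. - 2 * (v n \<bullet> e n \<omega>) \<le> sq_norm (v n) / 2"
    if ts: "\<forall>\<^sub>F n in sequentially. t n \<le> s n" and summ: "\<forall>e>0. summable (\<lambda>n. exp (- e * t n))" for t
  proof -
    have "\<forall>\<^sub>F n in sequentially. t n \<le> (\<Sum>i<n. (v n $ i)\<^sup>2)"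
      using ts eventually_ge_at_top[of N]
    proof eventually_elim
      case (elim n)
      thus ?case using sv[of n] v_sum[of n] by simp
    qed
    hence "AE \<omega> in P. \<forall>\<^sub>F n in sequentially.
        - 2 * (\<Sum>i<n. v n $ i * \<epsilon> n i \<omega>) \<le> (\<Sum>i<n. (v n $ i)\<^sup>2) / 2"
      by (rule AE_eventually_cross_term_le[OF \<open>prob_space P\<close> iso sigma _ summ])
    thus ?thesis
    proof eventually_elim
      case (elim \<omega>)
      thus ?case using eventually_ge_at_top[of N] by eventually_elim (simp add: v_sum v_e)
    qed
  qed
  have "AE \<omega> in P. \<forall>\<^sub>F n in sequentially. diff n \<omega> \<le> -1"
    using a_or_b
  proof (elim disjE conjE)
    \<comment> \<open>Condition (a): the noise of \<open>K\<^sub>B\<close> is at most \<open>s / 8 + s / 8\<close>, leaving at most \<open>- s / 4\<close>.\<close>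
    assume o: "(\<lambda>n. real (M n)) \<in> o(\<lambda>n. real n * \<delta> n * (bmin n)\<^sup>2)"
      and summ: "\<forall>e>0. summable (\<lambda>n. exp (- e * real n * \<delta> n * (bmin n)\<^sup>2))"
    have summ_s: "\<forall>e>0. summable (\<lambda>n. exp (- e * s n))"
      using summ by (simp add: s_def mult.assoc)
    have s_large: "\<forall>\<^sub>F n in sequentially. c \<le> s n" for c
      using eventually_ge_if_summable_exp[of s] summ_s[rule_format, of 1] by simp
    have M_small: "\<forall>\<^sub>F n in sequentially. real (M n) \<le> c * s n" if "c > 0" for c
      using landau_o.smallD[OF o that] s_large[of 0] by eventually_elim (simp add: s_def)
    have "AE \<omega> in P. \<forall>\<^sub>F n in sequentially.
        sq_norm (KB n *\<^sub>v vec n (\<lambda>i. \<epsilon> n i \<omega>)) \<le> \<sigma>\<^sup>2 * real (rW n) + 1 / 8 * s n"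
    proof (rule AE_eventually_sq_norm_projection_le[OF \<open>prob_space P\<close> iso sigma KB_squares _ summ_s])
      show "\<forall>\<^sub>F n in sequentially. real (rW n) \<le> s n"
        using M_small[of 1, simplified] eventually_ge_at_top[of N]
      proof eventually_elim
        case (elim n)
        thus ?case using rW_le[of n] by linarith
      qed
    qed auto
    moreover have "AE \<omega> in P. \<forall>\<^sub>F n in sequentially. - 2 * (v n \<bullet> e n \<omega>) \<le> sq_norm (v n) / 2"
      by (rule cross[OF _ summ_s]) auto
    ultimately show ?thesis
    proof eventually_elim
      case (elim \<omega>)
      have "1 / (8 * \<sigma>\<^sup>2) > 0" using sigma by simp
      from M_small[OF this] elim s_large[of 4] eventually_ge_at_top[of N] show ?case
      proof eventually_elim
        case (elim n)
        have "\<sigma>\<^sup>2 * real (rW n) \<le> \<sigma>\<^sup>2 * (1 / (8 * \<sigma>\<^sup>2) * s n)"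
          using elim(1) rW_le[OF elim(5)] by (intro mult_left_mono) auto
        also have "\<dots> = s n / 8" using sigma by simp
        finally show ?case
          using elim(2,3,4) HA_le[OF elim(5), of \<omega>] sv[OF elim(5)]
          unfolding diff_eq[OF elim(5)] e_def by linarith
      qed
    qed
  next
    \<comment> \<open>Condition (b): the three quadratic forms deviate from their means by at most \<open>3 c n / 8\<close>, the means by at most \<open>c n / 16\<close>, and at least \<open>c n / 2\<close> of the signal is left after the cross term.\<close>
    assume "\<exists>l. 0 \<le> l \<and> l < 1 \<and> (\<forall>A \<in> FA \<union> FB.
                (\<lambda>n. real (vec_space.rank n (H_mat ginv (X n) (A n))) / real n) \<longlonglongrightarrow> l)"
      and "\<exists>c>0. \<forall>n\<ge>N. \<delta> n * (bmin n)\<^sup>2 \<ge> c"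
    then obtain l c where l: "(\<lambda>n. real (rA n) / real n) \<longlonglongrightarrow> l" "(\<lambda>n. real (rB n) / real n) \<longlonglongrightarrow> l"
      and c: "c > 0" "\<And>n. n \<ge> N \<Longrightarrow> \<delta> n * (bmin n)\<^sup>2 \<ge> c"
      unfolding rA_def rB_def using AF BF by blast
    have cs: "c * real n \<le> s n" if "n \<ge> N" for n
      using mult_left_mono[OF c(2)[OF that], of "real n"] by (simp add: s_def mult_ac)
    have "(\<lambda>n. \<sigma>\<^sup>2 * (real (rA n) / real n - real (rB n) / real n)) \<longlonglongrightarrow> \<sigma>\<^sup>2 * (l - l)"
      by (intro tendsto_intros l)
    hence "\<forall>\<^sub>F n in sequentially. \<sigma>\<^sup>2 * (real (rA n) / real n - real (rB n) / real n) < c / 16"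
      by (rule order_tendstoD) (use c in simp)
    hence ranks: "\<forall>\<^sub>F n in sequentially. \<sigma>\<^sup>2 * (real (rA n) - real (rB n)) \<le> c / 16 * real n"
      using eventually_gt_at_top[of 0]
    proof eventually_elim
      case (elim n)
      have "\<sigma>\<^sup>2 * (real (rA n) - real (rB n)) = \<sigma>\<^sup>2 * (real (rA n) / real n - real (rB n) / real n) * real n"
        using elim(2) by (simp add: field_simps)
      also have "\<dots> \<le> c / 16 * real n" using elim(1) by (intro mult_right_mono) auto
      finally show ?case .
    qed
    have c8: "c / 8 > 0" using c by simp
    have "AE \<omega> in P. \<forall>\<^sub>F n in sequentially.
        sq_norm (KB n *\<^sub>v vec n (\<lambda>i. \<epsilon> n i \<omega>)) \<le> \<sigma>\<^sup>2 * real (rW n) + c / 8 * real n"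
    proof (rule AE_eventually_sq_norm_projection_le[OF \<open>prob_space P\<close> iso sigma KB_squares _ summable_exp_neg_mult_nat c8])
      show "\<forall>\<^sub>F n in sequentially. real (rW n) \<le> real n"
        using eventually_ge_at_top[of N]
      proof eventually_elim
        case (elim n)
        thus ?case using rank_sum[of n] by linarith
      qed
    qed
    moreover have "AE \<omega> in P. \<forall>\<^sub>F n in sequentially.
        sq_norm (HA n *\<^sub>v vec n (\<lambda>i. \<epsilon> n i \<omega>)) \<le> \<sigma>\<^sup>2 * real (rA n) + c / 8 * real n"
    proof (rule AE_eventually_sq_norm_projection_le[OF \<open>prob_space P\<close> iso sigma HA_squares _ summable_exp_neg_mult_nat c8])
      show "\<forall>\<^sub>F n in sequentially. real (rA n) \<le> real n"
        using eventually_ge_at_top[of N] by eventually_elim (use rA_le in simp)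
    qed
    moreover have "AE \<omega> in P. \<forall>\<^sub>F n in sequentially. \<sigma>\<^sup>2 * real n - c / 8 * real n \<le> (\<Sum>i<n. (\<epsilon> n i \<omega>)\<^sup>2)"
      by (rule AE_eventually_sq_norm_ge[OF \<open>prob_space P\<close> iso sigma c8])
    moreover have "AE \<omega> in P. \<forall>\<^sub>F n in sequentially. - 2 * (v n \<bullet> e n \<omega>) \<le> sq_norm (v n) / 2"
    proof (rule cross)
      show "\<forall>\<^sub>F n in sequentially. c * real n \<le> s n"
        using eventually_ge_at_top[of N] by eventually_elim (rule cs)
      show "\<forall>e>0. summable (\<lambda>n. exp (- e * (c * real n)))"
      proof (intro allI impI)
        fix e :: real assume "e > 0"
        thus "summable (\<lambda>n. exp (- e * (c * real n)))"
          using summable_exp_neg_mult_nat[rule_format, of "e * c"] c(1) by (simp add: mult.assoc)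
      qed
    qed
    ultimately show ?thesis
    proof eventually_elim
      case (elim \<omega>)
      have "\<forall>\<^sub>F n in sequentially. 16 / c \<le> real n" by real_asymp
      from this ranks elim eventually_ge_at_top[of N] show ?case
      proof eventually_elim
        case (elim n)
        have "real (rB n) + real (rW n) = real n" using rank_sum[OF elim(7)] by linarith
        hence "\<sigma>\<^sup>2 * (real (rB n) + real (rW n)) = \<sigma>\<^sup>2 * real n" by simp
        moreover have "c * real n \<ge> 16" using elim(1) c(1) by (simp add: field_simps)
        moreover have "sq_norm (e n \<omega>) = (\<Sum>i<n. (\<epsilon> n i \<omega>)\<^sup>2)" by (simp add: sq_norm_eq_sum e_def)
        ultimately show ?case
          using elim(2-6) cs[OF elim(7)] sv[OF elim(7)]
          unfolding diff_eq[OF elim(7)] e_def[symmetric] by (simp add: algebra_simps)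
      qed
    qed
  qed
  thus "AE \<omega> in P. limsup (\<lambda>n. ereal (rss ginv (X n) (response (X n) (\<beta> n) (\<lambda>i. \<epsilon> n i \<omega>)) (A n)
      - rss ginv (X n) (response (X n) (\<beta> n) (\<lambda>i. \<epsilon> n i \<omega>)) (B n))) < 0"
    unfolding diff_def by eventually_elim (rule limsup_neg_if_eventually_le_neg_one)
qed

end
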